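(* Let $1<p<N$ and let $\Omega\subset\mathbb{R}^N$ be a bounded domain containing the origin. There exists no $c>0$ such that $$\int_\Omega|\nabla u|^p\,dx-\left|\frac{N-p}{p}\right|^p\int_\Omega\frac{|u|^p}{|x|^p}\,dx\ \ge\ c\,\|u\|^p_{L^{\frac{Np}{N-p},\infty}}\qquad\text{for all } u\in W^{1,p}_0(\Omega).$$
   Context: For $1<q<\infty$ the weak $L^q$ norm is $$\|u\|_{L^{q,\infty}}=\sup_{E\subset\Omega}|E|^{\frac1q-1}\int_E|u|\,dx,$$ the supremum being over measurable sets $E\subset\Omega$ of positive measure. *)

theory Defs
  imports "HOL-Analysis.Analysis"
begin

definition partial_deriv :: "'a::euclidean_space \<Rightarrow> ('a \<Rightarrow> real) \<Rightarrow> 'a \<Rightarrow> real" where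
  "partial_deriv b f x = frechet_derivative f (at x) b"

definition classical_gradient :: "('a::euclidean_space \<Rightarrow> real) \<Rightarrow> 'a \<Rightarrow> 'a" where
  "classical_gradient f x = (\<Sum>b\<in>Basis. partial_deriv b f x *\<^sub>R b)"

(* C^infinity: every iterated partial derivative, the function itself included (bs = []),
   is differentiable everywhere, hence also continuous. *)
definition smooth :: "('a::euclidean_space \<Rightarrow> real) \<Rightarrow> bool" where
  "smooth f \<longleftrightarrow> (\<forall>bs\<in>lists Basis. \<forall>x. foldr partial_deriv bs f differentiable (at x))"

(* C_c^infinity(\<Omega>); its elements are identified with their extensions by 0 to the whole space. *)
definition test_functions :: "'a::euclidean_space set \<Rightarrow> ('a \<Rightarrow> real) set" where
  "test_functions \<Omega> =
     {\<phi>. smooth \<phi> \<and> compact (closure {x. \<phi> x \<noteq> 0}) \<and> closure {x. \<phi> x \<noteq> 0} \<subseteq> \<Omega>}"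

(* Membership in L^p(\<Omega>) for 1 <= p < infinity.  Only the values on \<Omega> matter. *)
definition in_Lp ::
  "real \<Rightarrow> 'a::euclidean_space set \<Rightarrow> ('a \<Rightarrow> 'b::euclidean_space) \<Rightarrow> bool" where
  "in_Lp p \<Omega> f \<longleftrightarrow>
     set_borel_measurable lebesgue \<Omega> f \<and> set_integrable lebesgue \<Omega> (\<lambda>x. norm (f x) powr p)"

definition locally_integrable ::
  "'a::euclidean_space set \<Rightarrow> ('a \<Rightarrow> 'b::euclidean_space) \<Rightarrow> bool" where
  "locally_integrable \<Omega> f \<longleftrightarrow> (\<forall>K. compact K \<and> K \<subseteq> \<Omega> \<longrightarrow> set_integrable lebesgue K f)"

(* A relation, since the weak gradient is determined only up to a null set of \<Omega>. *)
definition has_weak_gradient ::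
  "'a::euclidean_space set \<Rightarrow> ('a \<Rightarrow> real) \<Rightarrow> ('a \<Rightarrow> 'a) \<Rightarrow> bool" where
  "has_weak_gradient \<Omega> u g \<longleftrightarrow>
     locally_integrable \<Omega> u \<and> locally_integrable \<Omega> g \<and>
     (\<forall>\<phi>\<in>test_functions \<Omega>. \<forall>b\<in>Basis.
        (LINT x:\<Omega>|lebesgue. u x * partial_deriv b \<phi> x) =
        - (LINT x:\<Omega>|lebesgue. (g x \<bullet> b) * \<phi> x))"

(* W^{1,p}_0(\<Omega>): the closure of C_c^infinity(\<Omega>) in W^{1,p}(\<Omega>). The two limits together
   say that \<phi> n tends to u in the W^{1,p} norm. *)
definition sobolev_W0 :: "real \<Rightarrow> 'a::euclidean_space set \<Rightarrow> ('a \<Rightarrow> real) set" where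
  "sobolev_W0 p \<Omega> =
     {u. in_Lp p \<Omega> u \<and>
         (\<exists>g. has_weak_gradient \<Omega> u g \<and> in_Lp p \<Omega> g \<and>
            (\<exists>\<phi>. (\<forall>n. \<phi> n \<in> test_functions \<Omega>) \<and>
               (\<lambda>n::nat. LINT x:\<Omega>|lebesgue. \<bar>u x - \<phi> n x\<bar> powr p) \<longlonglongrightarrow> 0 \<and>
               (\<lambda>n. LINT x:\<Omega>|lebesgue. norm (g x - classical_gradient (\<phi> n) x) powr p)
                  \<longlonglongrightarrow> 0))}"

(* For q > 1 a set E of infinite measure contributes 0, in accordance with
   infinity^(1/q - 1) = 0: there measure lebesgue E = 0 and 0 powr _ = 0. *)
definition weak_Lq_norm :: "real \<Rightarrow> 'a::euclidean_space set \<Rightarrow> ('a \<Rightarrow> real) \<Rightarrow> ennreal" where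
  "weak_Lq_norm q \<Omega> u =
     (SUP E\<in>{E \<in> sets lebesgue. E \<subseteq> \<Omega> \<and> emeasure lebesgue E > 0}.
        ennreal (measure lebesgue E powr (1 / q - 1)) *
        (\<integral>\<^sup>+x\<in>E. ennreal \<bar>u x\<bar> \<partial>lebesgue))"

end

theory Submission
  imports Defs
begin

text \<open>The function \<open>|x|\<^sup>-\<^sup>\<gamma>\<close> with \<open>\<gamma> = (N - p) / p = N / q\<close> is a virtual extremal of Hardy's inequality and
  has finite, nonzero weak \<open>L\<^sup>q\<close> norm for the critical exponent \<open>q = N p / (N - p)\<close>. We cut it off slowly
  on the logarithmic scale: \<open>u x = |x|\<^sup>-\<^sup>\<gamma> W (ln |x| / L)\<close> with a fixed smooth bump \<open>W\<close> supported in
  \<open>[-2, -1]\<close>. Since \<open>(\<gamma> + 1) p = N\<close>, polar coordinates with \<open>t = ln |x| = L s\<close> turn the Hardy deficit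
  of \<open>u\<close> into a constant times \<open>L \<integral> (|\<gamma> W - W' / L|\<^sup>p - |\<gamma> W|\<^sup>p) ds\<close>. As \<open>L \<longrightarrow> \<infinity>\<close> this tends to a multiple
  of \<open>\<integral> (W\<^sup>p)' ds = 0\<close>, while scale invariance keeps the weak norm of \<open>u\<close> bounded below, as one sees by
  testing with a ball at distance \<open>exp (- 3 L / 2)\<close> from the origin.\<close>

subsection \<open>Smooth functions\<close>

text \<open>Smoothness localised to a set and graded by order: \<open>ln\<close> and
  \<open>inverse\<close> are smooth only on the positive half-line, and the closure properties are
  proved by induction on a finite order.\<close>

primrec times_differentiable_on :: "nat \<Rightarrow> 'a::euclidean_space set \<Rightarrow> ('a \<Rightarrow> real) \<Rightarrow> bool" where
  "times_differentiable_on 0 U f \<longleftrightarrow> True"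
| "times_differentiable_on (Suc k) U f \<longleftrightarrow>
     (\<forall>x\<in>U. f differentiable at x) \<and> (\<forall>b\<in>Basis. times_differentiable_on k U (partial_deriv b f))"

lemma partial_deriv_eq: "(f has_derivative f') (at x) \<Longrightarrow> partial_deriv b f x = f' b"
  unfolding partial_deriv_def by (metis frechet_derivative_at)

lemma partial_deriv_real: "(f has_real_derivative d) (at x) \<Longrightarrow> partial_deriv 1 f x = d"
  using partial_deriv_eq[of f "\<lambda>h. d * h" x 1] by (simp add: has_field_derivative_def)

lemma partial_deriv_cong_open:
  assumes "open U" "x \<in> U" "\<And>y. y \<in> U \<Longrightarrow> f y = g y" "f differentiable at x"
  shows "g differentiable at x" "partial_deriv b g x = partial_deriv b f x"
proof -
  obtain f' where f': "(f has_derivative f') (at x)"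
    using assms(4) by (auto simp: differentiable_def)
  have "(g has_derivative f') (at x)"
    using has_derivative_transform_within_open[OF f' assms(1,2)] assms(3) by auto
  then show "g differentiable at x" "partial_deriv b g x = partial_deriv b f x"
    using f' by (auto simp: differentiable_def partial_deriv_eq)
qed

text \<open>Inside the inductions this replaces the partial derivative of a compound function by its
  calculus formula, which is known on \<open>U\<close> only. Openness of \<open>U\<close> makes
  derivatives at its points depend on values in \<open>U\<close> alone.\<close>

lemma times_differentiable_on_cong:
  "\<lbrakk>open U; \<And>x. x \<in> U \<Longrightarrow> f x = g x; times_differentiable_on k U f\<rbrakk> \<Longrightarrow> times_differentiable_on k U g"
proof (induction k arbitrary: f g)
  case (Suc k)
  have "times_differentiable_on k U (partial_deriv b g)" if "b \<in> Basis" for b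
    by (rule Suc.IH[of "partial_deriv b f"])
      (use Suc.prems that in \<open>auto intro!: partial_deriv_cong_open(2)[where U=U, symmetric]\<close>)
  then show ?case
    using Suc.prems partial_deriv_cong_open(1)[of U _ f g] by auto
qed simp

lemma times_differentiable_on_Suc_D: "times_differentiable_on (Suc k) U f \<Longrightarrow> times_differentiable_on k U f"
  by (induction k arbitrary: f) auto

lemma times_differentiable_on_Un:
  "times_differentiable_on k U f \<Longrightarrow> times_differentiable_on k V f \<Longrightarrow> times_differentiable_on k (U \<union> V) f"
  by (induction k arbitrary: f) auto

lemma smooth_if_times_differentiable:
  assumes "\<And>k. times_differentiable_on k UNIV f"
  shows "smooth f"
proof -
  \<comment> \<open>Quantifying over \<open>k\<close> makes the induction work: the derivative in
    direction \<open>b\<close> uses up one order, so the tail of the list is treated at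
    \<open>Suc k\<close>.\<close>
  have "times_differentiable_on k UNIV (foldr partial_deriv bs f)" if "bs \<in> lists Basis" for bs k
    using that
  proof (induction bs arbitrary: k)
    case (Cons b bs)
    then show ?case
      using Cons.IH[of "Suc k"] by (metis times_differentiable_on.simps(2) foldr.simps(2) o_apply)
  qed (simp add: assms)
  from this[of _ "Suc 0"] show ?thesis by (simp add: smooth_def)
qed

lemma times_differentiable_on_const: "open U \<Longrightarrow> times_differentiable_on k U (\<lambda>x. c)"
proof (induction k arbitrary: c)
  case (Suc k)
  have "partial_deriv b (\<lambda>x. c) = (\<lambda>x. 0)" for b :: 'a
    by (rule ext, rule partial_deriv_eq) (auto intro!: derivative_eq_intros)
  then show ?case using Suc.IH[of 0] Suc.prems by simp
qed simp

lemma times_differentiable_on_inner: "open U \<Longrightarrow> times_differentiable_on k U (\<lambda>x. x \<bullet> a)"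
proof (cases k)
  case (Suc m)
  have "partial_deriv b (\<lambda>x. x \<bullet> a) = (\<lambda>x. b \<bullet> a)" for b :: 'a
    by (rule ext, rule partial_deriv_eq) (auto intro!: derivative_eq_intros)
  moreover assume "open U"
  ultimately show ?thesis using Suc by (simp add: times_differentiable_on_const)
qed simp

lemma times_differentiable_on_add:
  "open U \<Longrightarrow> times_differentiable_on k U f \<Longrightarrow> times_differentiable_on k U g \<Longrightarrow>
    times_differentiable_on k U (\<lambda>x. f x + g x)"
proof (induction k arbitrary: f g)
  case (Suc k)
  have "times_differentiable_on k U (partial_deriv b (\<lambda>x. f x + g x))" if "b \<in> Basis" for b
  proof (rule times_differentiable_on_cong[OF \<open>open U\<close>])
    show "times_differentiable_on k U (\<lambda>x. partial_deriv b f x + partial_deriv b g x)"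
      using Suc that by auto
    show "partial_deriv b f x + partial_deriv b g x = partial_deriv b (\<lambda>x. f x + g x) x" if x: "x \<in> U" for x
    proof -
      have "f differentiable at x" "g differentiable at x"
        using Suc.prems x by auto
      then obtain f' g' where *: "(f has_derivative f') (at x)" "(g has_derivative g') (at x)"
        by (auto simp: differentiable_def)
      show ?thesis
        using partial_deriv_eq[OF has_derivative_add[OF *]] *[THEN partial_deriv_eq] by simp
    qed
  qed
  then show ?case using Suc.prems by auto
qed simp

lemma times_differentiable_on_mult:
  "open U \<Longrightarrow> times_differentiable_on k U f \<Longrightarrow> times_differentiable_on k U g \<Longrightarrow>
    times_differentiable_on k U (\<lambda>x. f x * g x)"
proof (induction k arbitrary: f g)
  case (Suc k)
  have "times_differentiable_on k U (partial_deriv b (\<lambda>x. f x * g x))" if b: "b \<in> Basis" for b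
  proof (rule times_differentiable_on_cong[OF \<open>open U\<close>])
    show "times_differentiable_on k U (\<lambda>x. f x * partial_deriv b g x + partial_deriv b f x * g x)"
      using Suc.prems b Suc.prems(2,3)[THEN times_differentiable_on_Suc_D]
      by (intro times_differentiable_on_add Suc.IH) simp_all
    show "f x * partial_deriv b g x + partial_deriv b f x * g x = partial_deriv b (\<lambda>x. f x * g x) x"
      if x: "x \<in> U" for x
    proof -
      have "f differentiable at x" "g differentiable at x"
        using Suc.prems x by auto
      then obtain f' g' where *: "(f has_derivative f') (at x)" "(g has_derivative g') (at x)"
        by (auto simp: differentiable_def)
      show ?thesis
        using partial_deriv_eq[OF has_derivative_mult[OF *]] *[THEN partial_deriv_eq] by simp
    qed
  qed
  then show ?case using Suc.prems by auto
qed simp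

lemma times_differentiable_on_sum:
  "open U \<Longrightarrow> (\<And>i. i \<in> I \<Longrightarrow> times_differentiable_on k U (f i)) \<Longrightarrow>
    times_differentiable_on k U (\<lambda>x. \<Sum>i\<in>I. f i x)"
  by (induction I rule: infinite_finite_induct)
    (auto intro: times_differentiable_on_const times_differentiable_on_add)

lemma partial_deriv_compose_real:
  assumes "g differentiable at (h x)" "h differentiable at x"
  shows "partial_deriv b (\<lambda>x. g (h x)) x = partial_deriv 1 g (h x) * partial_deriv b h x"
proof -
  obtain d h' where *: "(g has_real_derivative d) (at (h x))" "(h has_derivative h') (at x)"
    using assms(1)[unfolded real_differentiable_def] assms(2)[unfolded differentiable_def] by blast
  have "((\<lambda>x. g (h x)) has_derivative (\<lambda>v. d * h' v)) (at x)"
    using has_derivative_compose[OF *(2)] *(1) unfolding has_field_derivative_def by blast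
  then show ?thesis
    using * by (simp add: partial_deriv_eq partial_deriv_real)
qed

text \<open>Only the outer function varies in the induction: the chain rule replaces
  \<open>g\<close> by its derivative, while \<open>h\<close> stays and merely loses one
  order.\<close>

lemma times_differentiable_on_compose:
  fixes g :: "real \<Rightarrow> real" and h :: "'a::euclidean_space \<Rightarrow> real"
  shows "open U \<Longrightarrow> h ` U \<subseteq> V \<Longrightarrow> times_differentiable_on k V g \<Longrightarrow> times_differentiable_on k U h \<Longrightarrow>
    times_differentiable_on k U (\<lambda>x. g (h x))"
proof (induction k arbitrary: g)
  case (Suc k)
  have diff: "g differentiable at (h x)" "h differentiable at x" if "x \<in> U" for x
    using that Suc.prems by auto
  have "times_differentiable_on k U (partial_deriv b (\<lambda>x. g (h x)))" if b: "b \<in> Basis" for b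
  proof (rule times_differentiable_on_cong[OF \<open>open U\<close>])
    show "times_differentiable_on k U (\<lambda>x. partial_deriv 1 g (h x) * partial_deriv b h x)"
    proof (rule times_differentiable_on_mult[OF \<open>open U\<close>])
      show "times_differentiable_on k U (\<lambda>x. partial_deriv 1 g (h x))"
        by (rule Suc.IH[OF Suc.prems(1,2) _ times_differentiable_on_Suc_D[OF Suc.prems(4)]])
          (use Suc.prems(3) in simp)
      show "times_differentiable_on k U (partial_deriv b h)"
        using Suc.prems b by simp
    qed
    show "partial_deriv 1 g (h x) * partial_deriv b h x = partial_deriv b (\<lambda>x. g (h x)) x" if "x \<in> U" for x
      using diff[OF that] by (rule partial_deriv_compose_real[symmetric])
  qed
  moreover have "(\<lambda>x. g (h x)) differentiable at x" if "x \<in> U" for x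
    using differentiable_chain_at[OF diff(2)[OF that] diff(1)[OF that]] by (simp add: o_def)
  ultimately show ?case by simp
qed simp

section \<open>Smooth functions of one real variable\<close>

lemma times_differentiable_on_real_SucI:
  fixes f f' :: "real \<Rightarrow> real"
  assumes "open U" "\<And>x. x \<in> U \<Longrightarrow> (f has_real_derivative f' x) (at x)" "times_differentiable_on k U f'"
  shows "times_differentiable_on (Suc k) U f"
proof -
  \<comment> \<open>The basis of the real line is {1}, so this is the only partial derivative that
    the recursion asks for.\<close>
  have "times_differentiable_on k U (partial_deriv 1 f)"
    using assms by (intro times_differentiable_on_cong[of U f' "partial_deriv 1 f" k])
      (auto intro!: partial_deriv_real[symmetric])
  then show ?thesis
    using assms(2) by (auto simp: real_differentiable_def)
qed

lemma times_differentiable_on_exp: "open U \<Longrightarrow> times_differentiable_on k U (exp :: real \<Rightarrow> real)"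
proof (induction k)
  case (Suc k)
  then show ?case
    using times_differentiable_on_real_SucI[OF Suc.prems DERIV_exp] by blast
qed simp

text \<open>The derivative is minus the square of \<open>inverse\<close> itself, so the product rule
  at order \<open>k\<close> closes the induction.\<close>

lemma times_differentiable_on_inverse: "times_differentiable_on k {0<..} (inverse :: real \<Rightarrow> real)"
proof (induction k)
  case (Suc k)
  have "(inverse has_real_derivative (- 1 * (inverse x * inverse x))) (at x)" if "x > 0" for x :: real
    using that by (auto intro!: derivative_eq_intros)
  moreover have "times_differentiable_on k {0<..} (\<lambda>x::real. - 1 * (inverse x * inverse x))"
    by (rule times_differentiable_on_mult[OF _ times_differentiable_on_const
          times_differentiable_on_mult[OF _ Suc Suc]]) auto
  ultimately show ?case
    by (intro times_differentiable_on_real_SucI[where f' = "\<lambda>x. - 1 * (inverse x * inverse x)"]) auto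
qed simp

lemma times_differentiable_on_ln: "times_differentiable_on k {0<..} (ln :: real \<Rightarrow> real)"
proof (cases k)
  case (Suc m)
  have "(ln has_real_derivative inverse x) (at x)" if "x \<in> {0<..}" for x :: real
    using that by (simp add: DERIV_ln)
  then show ?thesis
    unfolding Suc by (rule times_differentiable_on_real_SucI[OF open_greaterThan _ times_differentiable_on_inverse])
qed simp

text \<open>The polynomial factor makes the family closed under differentiation;
  \<open>P = 1\<close> gives the classical function exp (-1/x) that is flat at 0.\<close>

definition flat_exp :: "real poly \<Rightarrow> real \<Rightarrow> real" where
  "flat_exp P x = (if x > 0 then poly P (inverse x) * exp (- inverse x) else 0)"

lemma poly_times_exp_minus_tendsto_0:
  "((\<lambda>y. poly P y * exp (- y)) \<longlongrightarrow> (0::real)) at_top"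
proof -
  have "((\<lambda>y. \<Sum>i\<le>degree P. coeff P i * (y ^ i / exp y)) \<longlongrightarrow> (\<Sum>i\<le>degree P. coeff P i * 0)) at_top"
    by (intro tendsto_sum tendsto_mult tendsto_const tendsto_power_div_exp_0)
  then show ?thesis
    by (simp add: poly_altdef sum_distrib_right exp_minus divide_inverse mult.assoc)
qed

text \<open>For y = 1/x the derivative of P(y) exp (-y) in x is y^2 (P - P')(y) exp (-y), and the
  two \<open>pCons 0\<close> multiply by y^2. At 0 both one-sided difference quotients tend to
  0.\<close>

lemma flat_exp_has_derivative:
  "(flat_exp P has_real_derivative flat_exp (pCons 0 (pCons 0 (P - pderiv P))) x) (at x)"
proof -
  let ?Q = "pCons 0 (pCons 0 (P - pderiv P))"
  consider "x > 0" | "x < 0" | "x = 0" by linarith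
  then show ?thesis
  proof cases
    case 1
    have "((\<lambda>x. poly P (inverse x) * exp (- inverse x)) has_real_derivative flat_exp ?Q x) (at x)"
      using 1 unfolding flat_exp_def
      by (auto intro!: derivative_eq_intros DERIV_chain2[OF poly_DERIV] simp: field_simps)
    then show ?thesis
      by (rule has_field_derivative_transform_within_open[where S = "{0<..}"])
        (use 1 in \<open>auto simp: flat_exp_def\<close>)
  next
    case 2
    have "((\<lambda>x. 0) has_real_derivative flat_exp ?Q x) (at x)"
      using 2 by (simp add: flat_exp_def)
    then show ?thesis
      by (rule has_field_derivative_transform_within_open[where S = "{..<0}"])
        (use 2 in \<open>auto simp: flat_exp_def\<close>)
  next
    case 3
    \<comment> \<open>Dividing by \<open>y\<close> turns the polynomial in \<open>inverse y\<close>
      into \<open>pCons 0 P\<close>, and the exponential decay at infinity applies again.\<close>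
    have "((\<lambda>y. flat_exp P y / y) \<longlongrightarrow> 0) (at_right 0)"
    proof -
      have "((\<lambda>y. poly (pCons 0 P) (inverse y) * exp (- inverse y)) \<longlongrightarrow> (0::real)) (at_right 0)"
        using filterlim_compose[OF poly_times_exp_minus_tendsto_0 filterlim_inverse_at_top_right] .
      then show ?thesis
        by (rule Lim_transform_eventually)
          (auto simp: eventually_at_filter flat_exp_def field_simps intro!: always_eventually)
    qed
    moreover have "((\<lambda>y. flat_exp P y / y) \<longlongrightarrow> 0) (at_left 0)"
      by (rule Lim_transform_eventually[OF tendsto_const])
        (auto simp: eventually_at_filter flat_exp_def intro!: always_eventually)
    ultimately show ?thesis
      using 3 by (simp add: has_field_derivative_iff flat_exp_def filterlim_split_at)
  qed
qed

lemma times_differentiable_on_flat_exp: "open U \<Longrightarrow> times_differentiable_on k U (flat_exp P)"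
proof (induction k arbitrary: P)
  case (Suc k)
  then show ?case
    using times_differentiable_on_real_SucI[OF Suc.prems flat_exp_has_derivative] by blast
qed simp

subsection \<open>Integration by parts for test functions\<close>

lemma smooth_imp_differentiable: "smooth f \<Longrightarrow> f differentiable at x"
  unfolding smooth_def by (drule bspec[of _ _ "[]"]) auto

lemma smooth_partial_deriv: "smooth f \<Longrightarrow> b \<in> Basis \<Longrightarrow> smooth (partial_deriv b f)"
proof -
  assume "smooth f" "b \<in> Basis"
  then have "foldr partial_deriv (bs @ [b]) f differentiable at x" if "bs \<in> lists Basis" for bs x
    using that unfolding smooth_def by (elim ballE[of _ _ "bs @ [b]"]) auto
  then show ?thesis by (simp add: smooth_def)
qed

lemma smooth_imp_continuous: "smooth f \<Longrightarrow> continuous_on UNIV f"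
  by (simp add: continuous_at_imp_continuous_on differentiable_imp_continuous_within smooth_imp_differentiable)

lemma classical_gradient_inner: "b \<in> Basis \<Longrightarrow> classical_gradient f x \<bullet> b = partial_deriv b f x"
  by (simp add: classical_gradient_def inner_sum_left inner_Basis if_distrib cong: if_cong)

lemma partial_deriv_eq_0_outside:
  assumes "x \<notin> closure {x. f x \<noteq> 0}"
  shows "partial_deriv b f x = 0"
proof -
  have "partial_deriv b f x = partial_deriv b (\<lambda>x. 0) x"
    by (rule partial_deriv_cong_open(2)[of "- closure {x. f x \<noteq> 0}"])
      (use assms closure_subset[of "{x. f x \<noteq> 0}"] in auto)
  also have "\<dots> = 0"
    by (rule partial_deriv_eq) (auto intro!: derivative_eq_intros)
  finally show ?thesis .
qed

lemma classical_gradient_eq_0_outside: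
  "x \<notin> closure {x. f x \<noteq> 0} \<Longrightarrow> classical_gradient f x = 0"
  by (simp add: classical_gradient_def partial_deriv_eq_0_outside)

lemma integrable_continuous_compact_support:
  fixes f :: "'a::euclidean_space \<Rightarrow> 'b::euclidean_space"
  assumes "continuous_on UNIV f" "compact K" "\<And>x. x \<notin> K \<Longrightarrow> f x = 0"
  shows "integrable lborel f"
proof -
  have "integrable lborel (\<lambda>x. indicator K x *\<^sub>R f x)"
    by (rule borel_integrable_compact[OF assms(2) continuous_on_subset[OF assms(1) subset_UNIV]])
  moreover have "(\<lambda>x. indicator K x *\<^sub>R f x) = f"
    using assms(3) by (auto simp: indicator_def)
  ultimately show ?thesis by simp
qed

text \<open>The indicator of \<open>\<Omega>\<close> is absorbed by \<open>f\<close>. This moves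
  integrals to \<open>lborel\<close>, where translation invariance and polar coordinates are
  used.\<close>

lemma set_integral_lebesgue_eq_lborel:
  fixes f :: "'a::euclidean_space \<Rightarrow> 'b::euclidean_space"
  assumes "f \<in> borel_measurable borel" "\<And>x. x \<notin> \<Omega> \<Longrightarrow> f x = 0"
  shows "(LINT x:\<Omega>|lebesgue. f x) = (\<integral>x. f x \<partial>lborel)"
proof -
  have "(\<lambda>x. indicator \<Omega> x *\<^sub>R f x) = f"
    using assms(2) by (auto simp: indicator_def)
  then show ?thesis
    using integral_completion[of f lborel] assms(1) by (simp add: set_lebesgue_integral_def)
qed

lemma integral_translation_lborel:
  fixes f :: "'a::euclidean_space \<Rightarrow> real"
  assumes "f \<in> borel_measurable borel"
  shows "(\<integral>x. f (x + a) \<partial>lborel) = (\<integral>x. f x \<partial>lborel)"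
proof -
  have "(\<integral>x. f x \<partial>distr lborel borel ((+) a)) = (\<integral>x. f (a + x) \<partial>lborel)"
    by (rule integral_distr) (use assms in auto)
  then show ?thesis by (simp add: lborel_distr_plus add.commute)
qed

text \<open>The difference quotients in direction \<open>b\<close> have integral 0 by translation
  invariance, and dominated convergence passes this on to the derivative.\<close>

lemma integral_partial_deriv_eq_0:
  fixes f :: "'a::euclidean_space \<Rightarrow> real"
  assumes diff: "\<And>x. f differentiable at x" and cont: "continuous_on UNIV (partial_deriv b f)"
    and comp: "compact (closure {x. f x \<noteq> 0})" and b: "b \<in> Basis"
  shows "(\<integral>x. partial_deriv b f x \<partial>lborel) = 0"
proof -
  let ?K = "closure {x. f x \<noteq> 0}"
  define s where "s n x = (f (x + inverse (Suc n) *\<^sub>R b) - f x) / inverse (Suc n)" for n x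
  have line: "((\<lambda>t. f (x + t *\<^sub>R b)) has_real_derivative partial_deriv b f (x + t *\<^sub>R b)) (at t)" for x t
  proof -
    obtain f' where f': "(f has_derivative f') (at (x + t *\<^sub>R b))"
      using diff differentiable_def by blast
    then interpret bounded_linear f' by (rule has_derivative_bounded_linear)
    have "((\<lambda>t. f (x + t *\<^sub>R b)) has_derivative (\<lambda>h. f' (h *\<^sub>R b))) (at t)"
      by (rule has_derivative_compose[where f = "\<lambda>t. x + t *\<^sub>R b" and g = f, OF _ f'])
        (auto intro!: derivative_eq_intros)
    then show ?thesis
      unfolding has_field_derivative_def partial_deriv_eq[OF f'] by (simp add: scaleR mult.commute[of _ "f' b"])
  qed
  obtain R where R: "\<And>x. x \<in> ?K \<Longrightarrow> norm x \<le> R"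
    using comp compact_imp_bounded bounded_iff by metis
  have zero: "f x = 0" if "norm x > R" for x
    using R[of x] that closure_subset[of "{x. f x \<noteq> 0}"] by fastforce
  have "bounded (partial_deriv b f ` ?K)"
    using comp cont by (meson compact_continuous_image compact_imp_bounded continuous_on_subset subset_UNIV)
  then obtain B where B0: "\<And>x. x \<in> ?K \<Longrightarrow> \<bar>partial_deriv b f x\<bar> \<le> B"
    by (auto simp: bounded_iff)
  \<comment> \<open>The absolute value of \<open>B\<close> covers an empty support, where
    \<open>B0\<close> says nothing about its sign.\<close>
  have B: "\<bar>partial_deriv b f x\<bar> \<le> \<bar>B\<bar>" for x
    using B0[of x] partial_deriv_eq_0_outside[of x f b] by (cases "x \<in> ?K") auto
  have contf: "continuous_on UNIV f"
    by (simp add: continuous_at_imp_continuous_on diff differentiable_imp_continuous_within)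
  then have meas: "f \<in> borel_measurable borel"
    by (rule borel_measurable_continuous_onI)
  have intf: "integrable lborel f"
    by (rule integrable_continuous_compact_support[OF contf comp])
      (use closure_subset[of "{x. f x \<noteq> 0}"] in auto)
  have int_shift: "integrable lborel (\<lambda>x. f (x + a))" for a
  proof -
    have "integrable (distr lborel borel ((+) a)) f"
      using intf by (simp add: lborel_distr_plus)
    then show ?thesis
      by (subst (asm) integrable_distr_eq) (use meas in \<open>auto simp: add.commute\<close>)
  qed
  \<comment> \<open>By the mean value theorem along the line in direction \<open>b\<close>, every
    quotient obeys the bound of the derivative. As the shifts have length at most 1, all quotients
    vanish off the ball of radius \<open>R + 1\<close>.\<close>
  have "(\<lambda>n. \<integral>x. s n x \<partial>lborel) \<longlonglongrightarrow> (\<integral>x. partial_deriv b f x \<partial>lborel)"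
  proof (rule integral_dominated_convergence[where w = "\<lambda>x. indicator (cball 0 (R + 1)) x *\<^sub>R \<bar>B\<bar>"])
    show "integrable lborel (\<lambda>x::'a. indicator (cball 0 (R + 1)) x *\<^sub>R \<bar>B\<bar>)"
      by (rule borel_integrable_compact) auto
    show "partial_deriv b f \<in> borel_measurable lborel"
      using cont by (simp add: borel_measurable_continuous_onI)
    show "s n \<in> borel_measurable lborel" for n
      unfolding s_def using meas by measurable
    show "AE x in lborel. (\<lambda>n. s n x) \<longlonglongrightarrow> partial_deriv b f x"
    proof (rule AE_I2)
      fix x
      have "((\<lambda>h. (f (x + h *\<^sub>R b) - f x) / h) \<longlongrightarrow> partial_deriv b f x) (at 0)"
        using line[of x 0] by (simp add: DERIV_def)
      moreover have "filterlim (\<lambda>n. inverse (real (Suc n))) (at 0) sequentially"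
        unfolding filterlim_at using LIMSEQ_inverse_real_of_nat by (auto intro!: always_eventually)
      ultimately show "(\<lambda>n. s n x) \<longlonglongrightarrow> partial_deriv b f x"
        unfolding s_def by (rule filterlim_compose)
    qed
    show "AE x in lborel. norm (s n x) \<le> indicator (cball 0 (R + 1)) x *\<^sub>R \<bar>B\<bar>" for n
    proof (rule AE_I2)
      fix x
      let ?h = "inverse (real (Suc n))"
      have h: "0 < ?h" "?h \<le> 1" by (auto simp: field_simps)
      show "norm (s n x) \<le> indicator (cball 0 (R + 1)) x *\<^sub>R \<bar>B\<bar>"
      proof (cases "norm x \<le> R + 1")
        case True
        obtain z where "f (x + ?h *\<^sub>R b) - f (x + 0 *\<^sub>R b) = (?h - 0) * partial_deriv b f (x + z *\<^sub>R b)"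
          using MVT2[OF h(1), of "\<lambda>t. f (x + t *\<^sub>R b)" "\<lambda>t. partial_deriv b f (x + t *\<^sub>R b)"] line by blast
        then have "s n x = partial_deriv b f (x + z *\<^sub>R b)"
          unfolding s_def using h(1) by (simp del: of_nat_Suc)
        with B True show ?thesis by simp
      next
        case False
        have "norm x \<le> norm (x + ?h *\<^sub>R b) + norm (?h *\<^sub>R b)"
          by (metis add_diff_cancel_right' norm_triangle_ineq4)
        also have "norm (?h *\<^sub>R b) \<le> 1" using h b by simp
        finally have "f x = 0" "f (x + ?h *\<^sub>R b) = 0" using False by (auto intro!: zero)
        then show ?thesis by (simp add: s_def)
      qed
    qed
  qed
  moreover have "(\<integral>x. s n x \<partial>lborel) = 0" for n
  proof -
    have "(\<integral>x. s n x \<partial>lborel) = ((\<integral>x. f (x + inverse (Suc n) *\<^sub>R b) \<partial>lborel) - (\<integral>x. f x \<partial>lborel)) / inverse (Suc n)"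
      unfolding s_def using int_shift intf by simp
    then show ?thesis using integral_translation_lborel[OF meas] by simp
  qed
  ultimately show ?thesis
    by (simp add: LIMSEQ_const_iff)
qed

lemma
  assumes "\<phi> \<in> test_functions \<Omega>"
  shows test_function_smooth: "smooth \<phi>"
    and test_function_compact: "compact (closure {x. \<phi> x \<noteq> 0})"
    and test_function_eq_0: "x \<notin> \<Omega> \<Longrightarrow> \<phi> x = 0"
    and test_function_partial_deriv_eq_0: "x \<notin> \<Omega> \<Longrightarrow> partial_deriv b \<phi> x = 0"
  using assms closure_subset[of "{x. \<phi> x \<noteq> 0}"] partial_deriv_eq_0_outside[of x \<phi> b]
  by (auto simp: test_functions_def)

lemma continuous_classical_gradient:
  "smooth f \<Longrightarrow> continuous_on UNIV (classical_gradient f)"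
  unfolding classical_gradient_def[abs_def]
  by (intro continuous_intros smooth_imp_continuous smooth_partial_deriv)

text \<open>The product of \<open>u\<close> with another test function has compact support, so the
  integral of its partial derivative vanishes; the product rule splits this into the two sides of
  the weak formulation.\<close>

lemma test_function_has_weak_gradient:
  fixes u :: "'a::euclidean_space \<Rightarrow> real"
  assumes u: "u \<in> test_functions \<Omega>"
  shows "has_weak_gradient \<Omega> u (classical_gradient u)"
  unfolding has_weak_gradient_def
proof (intro conjI ballI)
  have loc: "locally_integrable \<Omega> f" if "continuous_on UNIV f" for f :: "'a \<Rightarrow> 'b::euclidean_space"
    unfolding locally_integrable_def set_integrable_def
  proof (intro allI impI)
    fix K assume K: "compact K \<and> K \<subseteq> \<Omega>"
    then have "integrable lborel (\<lambda>x. indicator K x *\<^sub>R f x)"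
      using borel_integrable_compact continuous_on_subset[OF that subset_UNIV] by blast
    then show "integrable lebesgue (\<lambda>x. indicator K x *\<^sub>R f x)"
      by (subst integrable_completion) auto
  qed
  have cu: "continuous_on UNIV u" "\<And>b. b \<in> Basis \<Longrightarrow> continuous_on UNIV (partial_deriv b u)"
    using test_function_smooth[OF u] by (simp_all add: smooth_imp_continuous smooth_partial_deriv)
  show "locally_integrable \<Omega> u"
    by (rule loc[OF cu(1)])
  show "locally_integrable \<Omega> (classical_gradient u)"
    by (intro loc continuous_classical_gradient test_function_smooth[OF u])
  fix \<phi> b assume \<phi>: "\<phi> \<in> test_functions \<Omega>" and b: "(b::'a) \<in> Basis"
  have cp: "continuous_on UNIV \<phi>" "continuous_on UNIV (partial_deriv b \<phi>)"
    using test_function_smooth[OF \<phi>] b by (simp_all add: smooth_imp_continuous smooth_partial_deriv)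
  have D: "u differentiable at x" "\<phi> differentiable at x" for x
    using test_function_smooth[OF u] test_function_smooth[OF \<phi>] by (auto intro: smooth_imp_differentiable)
  have prod: "partial_deriv b (\<lambda>x. u x * \<phi> x) x = u x * partial_deriv b \<phi> x + partial_deriv b u x * \<phi> x" for x
  proof -
    obtain u' p' where *: "(u has_derivative u') (at x)" "(\<phi> has_derivative p') (at x)"
      using D by (meson differentiable_def)
    show ?thesis
      using partial_deriv_eq[OF has_derivative_mult[OF *]] *[THEN partial_deriv_eq] by simp
  qed
  have "(\<integral>x. partial_deriv b (\<lambda>x. u x * \<phi> x) x \<partial>lborel) = 0"
  proof (rule integral_partial_deriv_eq_0[OF _ _ _ b])
    show "(\<lambda>x. u x * \<phi> x) differentiable at x" for x
      using D by (rule differentiable_mult)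
    show "continuous_on UNIV (partial_deriv b (\<lambda>x. u x * \<phi> x))"
      unfolding prod[abs_def] by (intro continuous_intros cu cp b)
    \<comment> \<open>The support of the product is a closed subset of the compact support of
      \<open>u\<close>; the intersection form expresses this.\<close>
    have "closure {x. u x \<noteq> 0} \<inter> closure {x. u x * \<phi> x \<noteq> 0} = closure {x. u x * \<phi> x \<noteq> 0}"
      using closure_mono[of "{x. u x * \<phi> x \<noteq> 0}" "{x. u x \<noteq> 0}"] by auto
    then show "compact (closure {x. u x * \<phi> x \<noteq> 0})"
      using compact_Int_closed[OF test_function_compact[OF u] closed_closure[of "{x. u x * \<phi> x \<noteq> 0}"]]
      by simp
  qed
  moreover have "integrable lborel (\<lambda>x. u x * partial_deriv b \<phi> x)"
    by (rule integrable_continuous_compact_support[OF continuous_on_mult[OF cu(1) cp(2)] test_function_compact[OF u]])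
      (use closure_subset[of "{x. u x \<noteq> 0}"] in auto)
  moreover have "integrable lborel (\<lambda>x. partial_deriv b u x * \<phi> x)"
    by (rule integrable_continuous_compact_support[OF continuous_on_mult[OF cu(2)[OF b] cp(1)] test_function_compact[OF u]])
      (simp add: partial_deriv_eq_0_outside)
  ultimately have "(\<integral>x. u x * partial_deriv b \<phi> x \<partial>lborel) + (\<integral>x. partial_deriv b u x * \<phi> x \<partial>lborel) = 0"
    by (simp add: prod)
  moreover have "(LINT x:\<Omega>|lebesgue. u x * partial_deriv b \<phi> x) = (\<integral>x. u x * partial_deriv b \<phi> x \<partial>lborel)"
    by (rule set_integral_lebesgue_eq_lborel[OF borel_measurable_continuous_onI[OF continuous_on_mult[OF cu(1) cp(2)]]])
      (simp add: test_function_eq_0[OF u])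
  moreover have "(LINT x:\<Omega>|lebesgue. (classical_gradient u x \<bullet> b) * \<phi> x) = (\<integral>x. partial_deriv b u x * \<phi> x \<partial>lborel)"
    unfolding classical_gradient_inner[OF b]
    by (rule set_integral_lebesgue_eq_lborel[OF borel_measurable_continuous_onI[OF continuous_on_mult[OF cu(2)[OF b] cp(1)]]])
      (simp add: test_function_eq_0[OF \<phi>])
  ultimately show "(LINT x:\<Omega>|lebesgue. u x * partial_deriv b \<phi> x) = - (LINT x:\<Omega>|lebesgue. (classical_gradient u x \<bullet> b) * \<phi> x)"
    by simp
qed

section \<open>Test functions as elements of the Sobolev space\<close>

lemma in_Lp_continuous_compact_support:
  fixes f :: "'a::euclidean_space \<Rightarrow> 'b::euclidean_space"
  assumes "continuous_on UNIV f" "compact K" "K \<subseteq> \<Omega>" "\<And>x. x \<notin> K \<Longrightarrow> f x = 0" "0 < p"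
  shows "in_Lp p \<Omega> f"
proof -
  have ind: "(\<lambda>x. indicator \<Omega> x *\<^sub>R f x) = f"
    "(\<lambda>x. indicator \<Omega> x *\<^sub>R (norm (f x) powr p)) = (\<lambda>x. norm (f x) powr p)"
    using assms(3,4) by (auto simp: indicator_def fun_eq_iff)
  have "integrable lborel (\<lambda>x. norm (f x) powr p)"
    by (rule integrable_continuous_compact_support[OF _ assms(2)])
      (use assms in \<open>auto intro!: continuous_intros continuous_on_powr'\<close>)
  then have "integrable lebesgue (\<lambda>x. norm (f x) powr p)"
    by (subst integrable_completion) auto
  moreover have "f \<in> borel_measurable lebesgue"
    using borel_measurable_continuous_onI[OF assms(1)] by (simp add: measurable_completion)
  ultimately show ?thesis
    by (simp add: in_Lp_def set_borel_measurable_def set_integrable_def ind[unfolded real_scaleR_def] ind)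
qed

text \<open>The constant sequence \<open>u\<close> approximates \<open>u\<close>, and the classical
  gradient serves as weak gradient.\<close>

lemma test_function_in_sobolev_W0:
  assumes u: "u \<in> test_functions \<Omega>" and "0 < p"
  shows "u \<in> sobolev_W0 p \<Omega>"
proof -
  let ?K = "closure {x. u x \<noteq> 0}"
  have K: "compact ?K" "?K \<subseteq> \<Omega>" using u by (auto simp: test_functions_def)
  have "in_Lp p \<Omega> u"
    by (rule in_Lp_continuous_compact_support[OF _ K])
      (use closure_subset[of "{x. u x \<noteq> 0}"] test_function_smooth[OF u] \<open>0 < p\<close> in \<open>auto intro: smooth_imp_continuous\<close>)
  moreover have "in_Lp p \<Omega> (classical_gradient u)"
    by (rule in_Lp_continuous_compact_support[OF _ K])
      (use test_function_smooth[OF u] \<open>0 < p\<close> in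
        \<open>auto intro: continuous_classical_gradient classical_gradient_eq_0_outside\<close>)
  ultimately show ?thesis
    unfolding sobolev_W0_def using test_function_has_weak_gradient[OF u] u
    by (auto intro!: exI[of _ "classical_gradient u"] exI[of _ "\<lambda>_. u"])
qed

text \<open>Boundedness will keep the weak norm of a test function finite on a set of finite
  measure.\<close>

lemma test_function_bounded:
  assumes "\<phi> \<in> test_functions \<Omega>"
  obtains B where "\<And>x. \<bar>\<phi> x\<bar> \<le> B"
proof -
  let ?K = "closure {x. \<phi> x \<noteq> 0}"
  have "bounded (\<phi> ` ?K)"
    by (intro compact_imp_bounded compact_continuous_image test_function_compact[OF assms]
        continuous_on_subset[OF smooth_imp_continuous[OF test_function_smooth[OF assms]]]) auto
  then obtain B where B: "\<forall>y\<in>\<phi> ` ?K. norm y \<le> B"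
    unfolding bounded_iff by blast
  have "\<bar>\<phi> x\<bar> \<le> \<bar>B\<bar>" for x
  proof (cases "\<phi> x = 0")
    case False
    then have "x \<in> ?K" using closure_subset by fastforce
    then have "norm (\<phi> x) \<le> B" using B by blast
    then show ?thesis by simp
  qed simp
  then show ?thesis using that by blast
qed

subsection \<open>Logarithmic polar coordinates\<close>

text \<open>Polar coordinates with the angle integrated out. Compact intervals form an
  intersection-stable generator of the Borel sets, and the preimage of [a, b] is a spherical shell
  whose volume is the integral of the density over [a, b].\<close>

lemma distr_ln_norm_lborel:
  "distr lborel borel (\<lambda>x::'a::euclidean_space. ln (norm x)) =
    density lborel (\<lambda>t. ennreal (unit_ball_vol (real DIM('a)) * real DIM('a) * exp (real DIM('a) * t)))"
    (is "?M = density lborel (\<lambda>t. ennreal (?d t))")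
proof (rule measure_eqI_generator_eq[where E = "range (\<lambda>(a, b). {a..b})" and \<Omega> = UNIV
      and A = "\<lambda>n. {- real n..real n}"])
  let ?N = "real DIM('a)" and ?\<omega> = "unit_ball_vol (real DIM('a))"
  have \<omega>: "0 \<le> ?\<omega>" by simp
  have M: "emeasure ?M {a..b} = ennreal (?\<omega> * exp (?N * b) - ?\<omega> * exp (?N * a))" if "a \<le> b" for a b
  proof -
    have "emeasure ?M {a..b} = emeasure lborel ((\<lambda>x::'a. ln (norm x)) -` {a..b})"
      by (subst emeasure_distr) auto
    \<comment> \<open>The sets agree off the origin, where \<open>ln 0 = 0\<close> may misplace one
      point; that point is a null set.\<close>
    also have "\<dots> = emeasure lborel (cball (0::'a) (exp b) - ball 0 (exp a))"
    proof (rule emeasure_eq_AE)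
      have "AE x in lborel. x \<noteq> (0::'a)"
        by (rule AE_lborel_singleton)
      then show "AE x in lborel. (x \<in> (\<lambda>x::'a. ln (norm x)) -` {a..b}) = (x \<in> cball 0 (exp b) - ball 0 (exp a))"
      proof eventually_elim
        case (elim x)
        then have "0 < norm x" by simp
        then have "ln (norm x) \<le> b \<longleftrightarrow> norm x \<le> exp b"
          using exp_le_cancel_iff[of "ln (norm x)" b] by simp
        then show ?case using \<open>0 < norm x\<close> by (auto simp: ln_ge_iff)
      qed
      show "(\<lambda>x::'a. ln (norm x)) -` {a..b} \<in> sets lborel"
        using measurable_sets[of "\<lambda>x::'a. ln (norm x)" borel borel "{a..b}"] by simp
    qed auto
    also have "\<dots> = emeasure lborel (cball (0::'a) (exp b)) - emeasure lborel (ball (0::'a) (exp a))"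
      by (rule emeasure_Diff) (use that in \<open>auto simp: emeasure_ball intro: order.trans[OF less_imp_le]\<close>)
    also have "\<dots> = ennreal (?\<omega> * exp (?N * b) - ?\<omega> * exp (?N * a))"
      using \<omega> by (simp add: emeasure_ball emeasure_cball ennreal_minus exp_of_nat_mult)
    finally show ?thesis .
  qed
  have D: "emeasure (density lborel (\<lambda>t. ennreal (?d t))) {a..b} = ennreal (?\<omega> * exp (?N * b) - ?\<omega> * exp (?N * a))"
    if "a \<le> b" for a b
  proof -
    have "emeasure (density lborel (\<lambda>t. ennreal (?d t))) {a..b} = (\<integral>\<^sup>+t. ennreal (?d t) * indicator {a..b} t \<partial>lborel)"
      by (rule emeasure_density) auto
    also have "\<dots> = ennreal (?\<omega> * exp (?N * b) - ?\<omega> * exp (?N * a))"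
      by (rule nn_integral_FTC_Icc[OF _ _ _ that]) (use \<omega> in \<open>auto intro!: derivative_eq_intros\<close>)
    finally show ?thesis .
  qed
  show "emeasure ?M X = emeasure (density lborel (\<lambda>t. ennreal (?d t))) X"
    if "X \<in> range (\<lambda>(a, b). {a..b})" for X
  proof -
    from that obtain a b where X: "X = {a..b}" by auto
    show ?thesis
      by (cases "a \<le> b") (simp_all add: X M D)
  qed
  show "emeasure ?M {- real n..real n} \<noteq> \<infinity>" for n
    by (subst M) auto
  show "Int_stable (range (\<lambda>(a, b). {a..b::real}))"
    unfolding Int_stable_def by clarsimp (auto intro!: image_eqI[of _ "\<lambda>(a, b). {a..b}" "(_, _)"])
  show "sets ?M = sigma_sets UNIV (range (\<lambda>(a, b). {a..b}))"
    "sets (density lborel (\<lambda>t. ennreal (?d t))) = sigma_sets UNIV (range (\<lambda>(a, b). {a..b}))"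
    by (auto simp: borel_eq_atLeastAtMost)
  show "(\<Union>n. {- real n..real n}) = UNIV"
  proof (intro set_eqI iffI UNIV_I)
    fix x :: real
    obtain n where "\<bar>x\<bar> \<le> real n" using real_arch_simple by blast
    then have "x \<in> {- real n..real n}" by auto
    then show "x \<in> (\<Union>n. {- real n..real n})" by blast
  qed
qed auto

lemma integral_ln_norm:
  fixes g :: "real \<Rightarrow> real"
  assumes [measurable]: "g \<in> borel_measurable borel"
  shows "(\<integral>x. g (ln (norm (x::'a::euclidean_space))) \<partial>lborel) =
    unit_ball_vol (real DIM('a)) * real DIM('a) * (\<integral>t. exp (real DIM('a) * t) * g t \<partial>lborel)"
proof -
  have "(\<integral>x. g (ln (norm (x::'a))) \<partial>lborel) = (\<integral>t. g t \<partial>distr lborel borel (\<lambda>x::'a. ln (norm x)))"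
    by (rule integral_distr[symmetric]) auto
  also have "\<dots> = (\<integral>t. (unit_ball_vol (real DIM('a)) * real DIM('a)) * (exp (real DIM('a) * t) * g t) \<partial>lborel)"
    unfolding distr_ln_norm_lborel by (subst integral_density) (auto simp: mult_ac)
  finally show ?thesis by simp
qed

text \<open>The weight |x|^(-N) cancels the exponential density of the image measure and leaves
  Lebesgue measure in t = ln |x|; the substitution t = L s contributes the factor
  \<open>L\<close>.\<close>

lemma integral_norm_powr_ln_norm:
  fixes \<Phi> :: "real \<Rightarrow> real"
  assumes [measurable]: "\<Phi> \<in> borel_measurable borel" and L: "0 < L"
  shows "(\<integral>x. norm (x::'a::euclidean_space) powr - real DIM('a) * \<Phi> (ln (norm x) / L) \<partial>lborel) =
    unit_ball_vol (real DIM('a)) * real DIM('a) * (L * (\<integral>s. \<Phi> s \<partial>lborel))"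
proof -
  let ?N = "real DIM('a)"
  have "(\<integral>x. norm (x::'a) powr - ?N * \<Phi> (ln (norm x) / L) \<partial>lborel) =
      (\<integral>x. (\<lambda>t. exp (- ?N * t) * \<Phi> (t / L)) (ln (norm (x::'a))) \<partial>lborel)"
  proof (rule integral_cong_AE)
    have "AE x in lborel. x \<noteq> (0::'a)"
      by (rule AE_lborel_singleton)
    then show "AE x in lborel. norm (x::'a) powr - ?N * \<Phi> (ln (norm x) / L) = exp (- ?N * ln (norm x)) * \<Phi> (ln (norm x) / L)"
      by eventually_elim (simp add: powr_def)
  qed auto
  also have "\<dots> = unit_ball_vol ?N * ?N * (\<integral>t. exp (?N * t) * (exp (- ?N * t) * \<Phi> (t / L)) \<partial>lborel)"
    by (rule integral_ln_norm) auto
  also have "(\<lambda>t. exp (?N * t) * (exp (- ?N * t) * \<Phi> (t / L))) = (\<lambda>t. \<Phi> (t / L))"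
    by (simp add: exp_minus fun_eq_iff)
  also have "(\<integral>t. \<Phi> (t / L) \<partial>lborel) = L * (\<integral>s. \<Phi> s \<partial>lborel)"
    using lborel_integral_real_affine[of L "\<lambda>t. \<Phi> (t / L)" 0] L by simp
  finally show ?thesis .
qed

subsection \<open>The one-dimensional deficit\<close>

lemma bump_function_exists:
  fixes a b :: real
  obtains W where "\<And>k. times_differentiable_on k UNIV W"
    "\<And>s. a < s \<Longrightarrow> s < b \<Longrightarrow> 0 < W s" "\<And>s. s \<notin> {a<..<b} \<Longrightarrow> W s = 0"
proof
  \<comment> \<open>Each factor is the flat function exp (-1/y) in the signed distance y to one
    endpoint. The inner products with \<open>1\<close> and \<open>-1\<close> are multiplications, in
    the shape that \<open>times_differentiable_on_inner\<close> treats.\<close>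
  let ?W = "\<lambda>s::real. flat_exp 1 (s \<bullet> 1 + (- a)) * flat_exp 1 (s \<bullet> (-1) + b)"
  have affine: "times_differentiable_on k UNIV (\<lambda>s::real. s \<bullet> c + d)" for k c d
    by (rule times_differentiable_on_add[OF _ times_differentiable_on_inner times_differentiable_on_const]) auto
  have flat: "times_differentiable_on k UNIV (\<lambda>s::real. flat_exp 1 (s \<bullet> c + d))" for k c d
    by (rule times_differentiable_on_compose[OF _ _ times_differentiable_on_flat_exp affine, where V = UNIV]) auto
  show "times_differentiable_on k UNIV ?W" for k
    by (rule times_differentiable_on_mult[OF open_UNIV flat flat])
  show "0 < ?W s" if "a < s" "s < b" for s
    using that by (simp add: flat_exp_def)
  show "?W s = 0" if "s \<notin> {a<..<b}" for s
    using that by (auto simp: flat_exp_def)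
qed

text \<open>Off 0 this is the power rule or a constant. At 0 the difference quotient equals
  \<open>max 0 h powr (p - 1)\<close>, which tends to 0 because the exponent is positive.\<close>

lemma DERIV_pos_part_powr:
  fixes p :: real
  assumes "1 < p"
  shows "((\<lambda>y. max 0 y powr p) has_real_derivative p * max 0 y powr (p - 1)) (at y)"
proof -
  consider "y > 0" | "y < 0" | "y = 0" by linarith
  then show ?thesis
  proof cases
    case 1
    have "((\<lambda>y. y powr p) has_real_derivative p * max 0 y powr (p - 1)) (at y)"
      using 1 by (auto intro!: derivative_eq_intros)
    then show ?thesis
      by (rule has_field_derivative_transform_within_open[where S = "{0<..}"]) (use 1 in auto)
  next
    case 2
    have "((\<lambda>y. 0) has_real_derivative p * max 0 y powr (p - 1)) (at y)"
      using 2 by simp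
    then show ?thesis
      by (rule has_field_derivative_transform_within_open[where S = "{..<0}"]) (use 2 in auto)
  next
    case 3
    have "((\<lambda>h::real. max 0 h powr (p - 1)) \<longlongrightarrow> max 0 0 powr (p - 1)) (at 0)"
      by (rule tendsto_powr'[OF tendsto_max[OF tendsto_const tendsto_ident_at] tendsto_const])
        (use assms in auto)
    moreover have "(\<lambda>h::real. max 0 h powr (p - 1)) = (\<lambda>h. max 0 h powr p / h)"
    proof
      fix h :: real
      show "max 0 h powr (p - 1) = max 0 h powr p / h"
        by (cases "h > 0") (auto simp: powr_diff)
    qed
    ultimately have "((\<lambda>h. max 0 h powr p / h) \<longlongrightarrow> 0) (at 0)"
      by simp
    then show ?thesis
      using 3 by (simp add: has_field_derivative_iff)
  qed
qed

text \<open>This is p |y|^(p-2) y. Splitting by the sign of \<open>y\<close> leaves the positive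
  exponent \<open>p - 1\<close> on nonnegative bases, so for \<open>1 < p\<close> continuity at 0 is
  visible even when p < 2.\<close>

definition abs_powr_deriv :: "real \<Rightarrow> real \<Rightarrow> real" where
  "abs_powr_deriv p y = p * (max 0 y powr (p - 1) - max 0 (- y) powr (p - 1))"

lemma DERIV_abs_powr:
  assumes "1 < p"
  shows "((\<lambda>y. \<bar>y\<bar> powr p) has_real_derivative abs_powr_deriv p y) (at y)"
proof -
  have "((\<lambda>y. max 0 y powr p + max 0 (- y) powr p) has_real_derivative abs_powr_deriv p y) (at y)"
    unfolding abs_powr_deriv_def
    by (rule derivative_eq_intros DERIV_pos_part_powr[OF assms]
        DERIV_chain2[where f = "\<lambda>y. max 0 y powr p", OF DERIV_pos_part_powr[OF assms]] refl)+
      (simp add: algebra_simps)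
  moreover have "(\<lambda>y. max 0 y powr p + max 0 (- y) powr p) = (\<lambda>y. \<bar>y\<bar> powr p)"
    using assms by (auto simp: fun_eq_iff max_def)
  ultimately show ?thesis by simp
qed

lemma abs_abs_powr_deriv_le:
  assumes "1 < p" "\<bar>y\<bar> \<le> M"
  shows "\<bar>abs_powr_deriv p y\<bar> \<le> p * M powr (p - 1)"
proof -
  have "\<bar>abs_powr_deriv p y\<bar> = p * \<bar>y\<bar> powr (p - 1)"
    using assms by (auto simp: abs_powr_deriv_def abs_mult max_def)
  also have "\<dots> \<le> p * M powr (p - 1)"
    using assms by (intro mult_left_mono powr_mono2) auto
  finally show ?thesis .
qed

lemma continuous_on_abs_powr_deriv: "1 < p \<Longrightarrow> continuous_on UNIV (abs_powr_deriv p)"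
  unfolding abs_powr_deriv_def[abs_def]
  by (intro continuous_intros continuous_on_powr') auto

text \<open>With \<open>h = 1 / L\<close> this is the difference quotient at \<open>h = 0\<close> of the integral of \<open>|\<gamma> W - h W'|\<^sup>p\<close>.
  It tends to the integral of a constant multiple of the derivative of \<open>(\<gamma> W)\<^sup>p\<close>, which vanishes
  because \<open>W\<close> has compact support.\<close>

lemma scaled_deficit_tendsto_0:
  fixes W W' :: "real \<Rightarrow> real"
  assumes p: "1 < p" and g: "0 < \<gamma>"
    and W: "\<And>s. (W has_real_derivative W' s) (at s)" and contW': "continuous_on UNIV W'"
    and supp: "\<And>s. s \<notin> {a..b} \<Longrightarrow> W s = 0"
  shows "(\<lambda>n. real (Suc n) * ((\<integral>s. \<bar>\<gamma> * W s - W' s / real (Suc n)\<bar> powr p \<partial>lborel)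
      - \<gamma> powr p * (\<integral>s. \<bar>W s\<bar> powr p \<partial>lborel))) \<longlonglongrightarrow> 0"
proof -
  have contW: "continuous_on UNIV W"
    by (intro continuous_at_imp_continuous_on ballI DERIV_isCont[OF W])
  have clo: "closure {s. W s \<noteq> 0} \<subseteq> {a..b}"
    by (rule closure_minimal) (use supp in \<open>fastforce intro: ccontr\<close>, simp)
  have supp': "W' s = 0" if "s \<notin> {a..b}" for s
  proof -
    have "s \<notin> closure {s. W s \<noteq> 0}" using clo that by blast
    then show ?thesis
      using partial_deriv_eq_0_outside[of s W 1] partial_deriv_real[OF W, of s] by simp
  qed
  have "bounded ((\<lambda>s. \<bar>\<gamma> * W s\<bar> + \<bar>W' s\<bar>) ` {a..b})"
    by (intro compact_imp_bounded compact_continuous_image compact_Icc continuous_intros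
        continuous_on_subset[OF contW] continuous_on_subset[OF contW']) auto
  then obtain M where "\<forall>y\<in>(\<lambda>s. \<bar>\<gamma> * W s\<bar> + \<bar>W' s\<bar>) ` {a..b}. norm y \<le> M"
    unfolding bounded_iff by blast
  then have "norm (\<bar>\<gamma> * W s\<bar> + \<bar>W' s\<bar>) \<le> M" if "s \<in> {a..b}" for s
    using that by blast
  then have M0: "\<bar>\<gamma> * W s\<bar> + \<bar>W' s\<bar> \<le> M" if "s \<in> {a..b}" for s
    using that by fastforce
  define \<phi> where "\<phi> n s = real (Suc n) * (\<bar>\<gamma> * W s - W' s / real (Suc n)\<bar> powr p - \<bar>\<gamma> * W s\<bar> powr p)" for n s
  \<comment> \<open>The parameter \<open>t\<close> interpolates between the pure power, at 0, and
    the truncated extremal, at 1 / (n + 1).\<close>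
  have line: "((\<lambda>t. \<bar>\<gamma> * W s - t * W' s\<bar> powr p) has_real_derivative
      - W' s * abs_powr_deriv p (\<gamma> * W s - t * W' s)) (at t)" for s t
    by (rule DERIV_cong[OF DERIV_chain2[where f = "\<lambda>y. \<bar>y\<bar> powr p" and Db = "- W' s", OF DERIV_abs_powr[OF p]]])
      (auto intro!: derivative_eq_intros)
  have \<phi>_alt: "\<phi> n s = (\<bar>\<gamma> * W s - inverse (real (Suc n)) * W' s\<bar> powr p - \<bar>\<gamma> * W s - 0 * W' s\<bar> powr p) / inverse (real (Suc n))" for n s
    by (simp add: \<phi>_def field_simps)
  have int1: "integrable lborel (\<lambda>s. \<bar>\<gamma> * W s - W' s / real (Suc n)\<bar> powr p)" for n
    by (rule integrable_continuous_compact_support[OF _ compact_Icc[of a b]])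
      (use supp supp' p in \<open>auto intro!: continuous_intros continuous_on_powr' contW contW'\<close>)
  have int2: "integrable lborel (\<lambda>s. \<bar>W s\<bar> powr p)"
    by (rule integrable_continuous_compact_support[OF _ compact_Icc[of a b]])
      (use supp p in \<open>auto intro!: continuous_intros continuous_on_powr' contW\<close>)
  have pull: "\<bar>\<gamma> * W s\<bar> powr p = \<gamma> powr p * \<bar>W s\<bar> powr p" for s
    using g by (simp add: abs_mult powr_mult)
  \<comment> \<open>On the support, \<open>M\<close> bounds |W'| as well as |\<gamma> W - z W'| for
    all z in [0, 1], so the mean value theorem dominates every quotient by one constant.\<close>
  have "(\<lambda>n. \<integral>s. \<phi> n s \<partial>lborel) \<longlonglongrightarrow> (\<integral>s. - W' s * abs_powr_deriv p (\<gamma> * W s) \<partial>lborel)"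
  proof (rule integral_dominated_convergence[where w = "\<lambda>s. indicator {a..b} s *\<^sub>R (M * (p * M powr (p - 1)))"])
    show "integrable lborel (\<lambda>s. indicator {a..b} s *\<^sub>R (M * (p * M powr (p - 1))))"
      by (rule borel_integrable_compact) auto
    show "(\<lambda>s. - W' s * abs_powr_deriv p (\<gamma> * W s)) \<in> borel_measurable lborel"
      by (simp, rule borel_measurable_continuous_onI)
        (intro continuous_intros contW' contW continuous_on_compose2[OF continuous_on_abs_powr_deriv[OF p]], auto)
    show "\<phi> n \<in> borel_measurable lborel" for n
      unfolding \<phi>_def using borel_measurable_continuous_onI[OF contW] borel_measurable_continuous_onI[OF contW'] by measurable
    show "AE s in lborel. (\<lambda>n. \<phi> n s) \<longlonglongrightarrow> - W' s * abs_powr_deriv p (\<gamma> * W s)"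
    proof (rule AE_I2)
      fix s
      have "((\<lambda>h. (\<bar>\<gamma> * W s - h * W' s\<bar> powr p - \<bar>\<gamma> * W s - 0 * W' s\<bar> powr p) / h)
          \<longlongrightarrow> - W' s * abs_powr_deriv p (\<gamma> * W s)) (at 0)"
        using line[of s 0] by (simp add: DERIV_def)
      moreover have "filterlim (\<lambda>n. inverse (real (Suc n))) (at 0) sequentially"
        unfolding filterlim_at using LIMSEQ_inverse_real_of_nat by (auto intro!: always_eventually)
      ultimately show "(\<lambda>n. \<phi> n s) \<longlonglongrightarrow> - W' s * abs_powr_deriv p (\<gamma> * W s)"
        unfolding \<phi>_alt by (rule filterlim_compose)
    qed
    show "AE s in lborel. norm (\<phi> n s) \<le> indicator {a..b} s *\<^sub>R (M * (p * M powr (p - 1)))" for n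
    proof (rule AE_I2)
      fix s
      let ?h = "inverse (real (Suc n))"
      have h: "0 < ?h" "?h \<le> 1" by (auto simp: field_simps)
      show "norm (\<phi> n s) \<le> indicator {a..b} s *\<^sub>R (M * (p * M powr (p - 1)))"
      proof (cases "s \<in> {a..b}")
        case True
        obtain z where z: "0 < z" "z < ?h" and
          eq: "\<bar>\<gamma> * W s - ?h * W' s\<bar> powr p - \<bar>\<gamma> * W s - 0 * W' s\<bar> powr p
              = (?h - 0) * (- W' s * abs_powr_deriv p (\<gamma> * W s - z * W' s))"
          using MVT2[OF h(1) line[of s]] by blast
        have "\<bar>z * W' s\<bar> \<le> 1 * \<bar>W' s\<bar>"
          unfolding abs_mult using z h by (intro mult_right_mono) auto
        then have "\<bar>\<gamma> * W s - z * W' s\<bar> \<le> M"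
          using M0[OF True] by linarith
        then have le: "\<bar>abs_powr_deriv p (\<gamma> * W s - z * W' s)\<bar> \<le> p * M powr (p - 1)"
          by (rule abs_abs_powr_deriv_le[OF p])
        have "\<phi> n s = - W' s * abs_powr_deriv p (\<gamma> * W s - z * W' s)"
          unfolding \<phi>_alt eq using h(1) by (simp del: of_nat_Suc)
        then have "norm (\<phi> n s) = \<bar>W' s\<bar> * \<bar>abs_powr_deriv p (\<gamma> * W s - z * W' s)\<bar>"
          by (simp add: abs_mult)
        also have "\<dots> \<le> M * (p * M powr (p - 1))"
          using M0[OF True] le by (intro mult_mono) auto
        finally show ?thesis using True by simp
      next
        case False
        then show ?thesis using supp supp' by (simp add: \<phi>_def)
      qed
    qed
  qed
  also have "(\<integral>s. - W' s * abs_powr_deriv p (\<gamma> * W s) \<partial>lborel) = 0"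
  proof -
    let ?f = "\<lambda>s. \<bar>\<gamma> * W s\<bar> powr p"
    have f: "(?f has_real_derivative abs_powr_deriv p (\<gamma> * W s) * (\<gamma> * W' s)) (at s)" for s
      by (rule DERIV_chain2[where f = "\<lambda>y. \<bar>y\<bar> powr p", OF DERIV_abs_powr[OF p]])
        (auto intro!: derivative_eq_intros W)
    have pd: "partial_deriv 1 ?f = (\<lambda>s. abs_powr_deriv p (\<gamma> * W s) * (\<gamma> * W' s))"
      by (rule ext, rule partial_deriv_real[OF f])
    have "{s. ?f s \<noteq> 0} = {s. W s \<noteq> 0}" using g by auto
    then have "closure {s. ?f s \<noteq> 0} = {a..b} \<inter> closure {s. W s \<noteq> 0}"
      using clo by auto
    then have comp: "compact (closure {s. ?f s \<noteq> 0})"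
      by (metis closed_closure compact_Icc compact_Int_closed)
    have "(\<integral>s. partial_deriv 1 ?f s \<partial>lborel) = 0"
    proof (rule integral_partial_deriv_eq_0[OF _ _ comp])
      show "?f differentiable at s" for s
        using f real_differentiable_def by blast
      show "continuous_on UNIV (partial_deriv 1 ?f)"
        unfolding pd
        by (intro continuous_intros contW' contW continuous_on_compose2[OF continuous_on_abs_powr_deriv[OF p]]) auto
    qed simp
    \<comment> \<open>The limit integrand is thus -1 / \<gamma> times an exact derivative.\<close>
    moreover have "partial_deriv 1 ?f s = - \<gamma> * (- W' s * abs_powr_deriv p (\<gamma> * W s))" for s
      by (simp add: pd)
    ultimately show ?thesis using g by simp
  qed
  also have "(\<lambda>n. \<integral>s. \<phi> n s \<partial>lborel) = (\<lambda>n. real (Suc n) * ((\<integral>s. \<bar>\<gamma> * W s - W' s / real (Suc n)\<bar> powr p \<partial>lborel)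
      - \<gamma> powr p * (\<integral>s. \<bar>W s\<bar> powr p \<partial>lborel)))"
    using int1 int2 by (simp add: \<phi>_def pull del: of_nat_Suc)
  finally show ?thesis .
qed

subsection \<open>The weak norm\<close>

text \<open>Each admissible \<open>E\<close> contributes at most |B| |E|^(1/q), which grows with
  \<open>E\<close>. Finiteness matters because \<open>enn2real\<close> sends infinity to 0, which
  would destroy the lower bound on the weak norm.\<close>

lemma weak_Lq_norm_finite:
  assumes "\<And>x. x \<in> \<Omega> \<Longrightarrow> \<bar>u x\<bar> \<le> B" and q: "0 < q" and \<Omega>: "\<Omega> \<in> lmeasurable"
  shows "weak_Lq_norm q \<Omega> u < \<infinity>"
proof -
  have "weak_Lq_norm q \<Omega> u \<le> ennreal (\<bar>B\<bar> * measure lebesgue \<Omega> powr (1 / q))"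
    unfolding weak_Lq_norm_def
  proof (rule SUP_least)
    fix E assume "E \<in> {E \<in> sets lebesgue. E \<subseteq> \<Omega> \<and> emeasure lebesgue E > 0}"
    then have E: "E \<in> sets lebesgue" "E \<subseteq> \<Omega>" "emeasure lebesgue E > 0" by auto
    have lm: "E \<in> lmeasurable"
      using fmeasurableI2[OF \<Omega> E(2,1)] .
    then have em: "emeasure lebesgue E = ennreal (measure lebesgue E)"
      by (rule emeasure_eq_measure2)
    then have pos: "0 < measure lebesgue E" using E(3) by simp
    have "(\<integral>\<^sup>+x\<in>E. ennreal \<bar>u x\<bar> \<partial>lebesgue) \<le> (\<integral>\<^sup>+x. ennreal \<bar>B\<bar> * indicator E x \<partial>lebesgue)"
      using assms(1) E(2) by (intro nn_integral_mono) (force simp: indicator_def intro!: ennreal_leI)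
    also have "\<dots> = ennreal (\<bar>B\<bar> * measure lebesgue E)"
      using E(1) by (simp add: nn_integral_cmult_indicator em ennreal_mult')
    finally have "ennreal (measure lebesgue E powr (1 / q - 1)) * (\<integral>\<^sup>+x\<in>E. ennreal \<bar>u x\<bar> \<partial>lebesgue)
        \<le> ennreal (measure lebesgue E powr (1 / q - 1)) * ennreal (\<bar>B\<bar> * measure lebesgue E)"
      by (rule mult_left_mono) simp
    also have "\<dots> = ennreal (\<bar>B\<bar> * measure lebesgue E powr (1 / q))"
      using pos by (simp add: ennreal_mult'[symmetric] powr_diff)
    also have "\<dots> \<le> ennreal (\<bar>B\<bar> * measure lebesgue \<Omega> powr (1 / q))"
      using q measure_mono_fmeasurable[OF E(2,1) \<Omega>]
      by (intro ennreal_leI mult_left_mono powr_mono2) auto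
    finally show "ennreal (measure lebesgue E powr (1 / q - 1)) * (\<integral>\<^sup>+x\<in>E. ennreal \<bar>u x\<bar> \<partial>lebesgue)
        \<le> ennreal (\<bar>B\<bar> * measure lebesgue \<Omega> powr (1 / q))" .
  qed
  then show ?thesis
    using ennreal_less_top le_less_trans by (metis infinity_ennreal_def)
qed

text \<open>A single set already bounds the supremum from below: \<open>E\<close> contributes at
  least |E|^(1/q - 1) times v |E|.\<close>

lemma weak_Lq_norm_ge:
  assumes E: "E \<in> lmeasurable" "E \<subseteq> \<Omega>" "0 < measure lebesgue E"
    and v: "\<And>x. x \<in> E \<Longrightarrow> v \<le> u x" "0 \<le> v"
  shows "ennreal (v * measure lebesgue E powr (1 / q)) \<le> weak_Lq_norm q \<Omega> u"
proof -
  have em: "emeasure lebesgue E = ennreal (measure lebesgue E)"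
    using E(1) by (rule emeasure_eq_measure2)
  have "ennreal (v * measure lebesgue E powr (1 / q)) =
      ennreal (measure lebesgue E powr (1 / q - 1)) * ennreal (v * measure lebesgue E)"
    using E(3) v(2) by (simp add: ennreal_mult'[symmetric] powr_diff)
  also have "ennreal (v * measure lebesgue E) = (\<integral>\<^sup>+x. ennreal v * indicator E x \<partial>lebesgue)"
    using E(1) v(2) by (simp add: nn_integral_cmult_indicator em ennreal_mult' fmeasurableD)
  also have "\<dots> \<le> (\<integral>\<^sup>+x\<in>E. ennreal \<bar>u x\<bar> \<partial>lebesgue)"
    using v by (intro nn_integral_mono) (force simp: indicator_def intro!: ennreal_leI)
  finally have "ennreal (v * measure lebesgue E powr (1 / q)) \<le>
      ennreal (measure lebesgue E powr (1 / q - 1)) * (\<integral>\<^sup>+x\<in>E. ennreal \<bar>u x\<bar> \<partial>lebesgue)"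
    by (simp add: mult_left_mono)
  also have "\<dots> \<le> weak_Lq_norm q \<Omega> u"
    unfolding weak_Lq_norm_def by (rule SUP_upper) (use E em in \<open>auto simp: fmeasurableD\<close>)
  finally show ?thesis .
qed

subsection \<open>Truncated extremals\<close>

text \<open>\<open>W\<close> is the profile in the variable s = ln |x| / L and \<open>L\<close> the
  logarithmic length scale. The condition \<open>b < 0\<close> places the support inside the unit
  ball, nearer to the origin as \<open>L\<close> grows, and forces \<open>W 0 = 0\<close>.\<close>

locale log_profile =
  fixes W W' :: "real \<Rightarrow> real" and a b \<gamma> L :: real
  assumes W_diff: "\<And>k. times_differentiable_on k UNIV W"
    and W_deriv: "\<And>s. (W has_real_derivative W' s) (at s)"
    and W'_cont: "continuous_on UNIV W'"
    and W_supp: "\<And>s. s \<notin> {a<..<b} \<Longrightarrow> W s = 0"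
    and b_neg: "b < 0" and L_pos: "0 < L"
begin

text \<open>\<open>u x = |x|\<^sup>-\<^sup>\<gamma> W (ln |x| / L)\<close>, written through \<open>x \<bullet> x\<close>, which is smooth. At the origin \<open>ln 0 = 0\<close>
  gives the correct value \<open>0\<close> because \<open>W\<close> vanishes at \<open>0\<close>.\<close>

definition u :: "'a::euclidean_space \<Rightarrow> real" where
  "u x = exp (ln (x \<bullet> x) \<bullet> (- \<gamma> / 2)) * W (ln (x \<bullet> x) \<bullet> (1 / (2 * L)))"

lemma ln_inner_self: "x \<noteq> 0 \<Longrightarrow> ln (x \<bullet> x) = 2 * ln (norm x)"
  by (simp add: dot_square_norm ln_realpow)

lemma u_eq: "x \<noteq> 0 \<Longrightarrow> u x = norm x powr - \<gamma> * W (ln (norm x) / L)"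
  by (simp add: u_def ln_inner_self powr_def)

lemma u_zero: "u 0 = 0"
  using b_neg by (simp add: u_def W_supp)

lemma u_support:
  assumes "u x \<noteq> 0"
  shows "exp (a * L) < norm x" "norm x < exp (b * L)"
proof -
  have x: "x \<noteq> 0" using assms u_zero by auto
  then have "W (ln (norm x) / L) \<noteq> 0" using assms by (simp add: u_eq)
  then have "a < ln (norm x) / L" "ln (norm x) / L < b" using W_supp by force+
  then have "a * L < ln (norm x)" "ln (norm x) < b * L"
    using L_pos by (simp_all add: pos_less_divide_eq pos_divide_less_eq)
  then have "exp (a * L) < exp (ln (norm x))" "exp (ln (norm x)) < exp (b * L)"
    by simp_all
  then show "exp (a * L) < norm x" "norm x < exp (b * L)"
    using x by simp_all
qed

text \<open>Two open sets cover the space: off the origin \<open>u\<close> is a composition of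
  smooth functions, and on the ball of radius exp (a L) it vanishes identically.\<close>

lemma times_differentiable_on_u: "times_differentiable_on k UNIV (u :: 'a::euclidean_space \<Rightarrow> real)"
proof -
  \<comment> \<open>The squared norm is written in coordinates because the closure lemmas treat
    linear functionals, products and sums.\<close>
  have sq: "times_differentiable_on k (- {0}) (\<lambda>x::'a. \<Sum>i\<in>Basis. (x \<bullet> i) * (x \<bullet> i))"
  proof (rule times_differentiable_on_sum)
    show "times_differentiable_on k (- {0}) (\<lambda>x::'a. (x \<bullet> i) * (x \<bullet> i))" for i
      by (rule times_differentiable_on_mult[OF _ times_differentiable_on_inner times_differentiable_on_inner]) auto
  qed auto
  have "times_differentiable_on k (- {0}) (\<lambda>x::'a. ln (\<Sum>i\<in>Basis. (x \<bullet> i) * (x \<bullet> i)))"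
    by (rule times_differentiable_on_compose[OF _ _ times_differentiable_on_ln sq])
      (auto simp: euclidean_inner[symmetric])
  then have ln: "times_differentiable_on k (- {0}) (\<lambda>x::'a. ln (x \<bullet> x))"
    by (simp add: euclidean_inner[symmetric])
  have scaled: "times_differentiable_on k (UNIV::real set) (\<lambda>t. g (t \<bullet> c))"
    if "times_differentiable_on k UNIV g" for g c
    by (rule times_differentiable_on_compose[OF _ _ that times_differentiable_on_inner]) auto
  have "times_differentiable_on k (UNIV::real set) (\<lambda>t. exp (t \<bullet> (- \<gamma> / 2)) * W (t \<bullet> (1 / (2 * L))))"
    by (rule times_differentiable_on_mult[OF open_UNIV scaled[OF times_differentiable_on_exp[OF open_UNIV]] scaled[OF W_diff]])
  then have "times_differentiable_on k (- {0}) (\<lambda>x::'a. (\<lambda>t. exp (t \<bullet> (- \<gamma> / 2)) * W (t \<bullet> (1 / (2 * L)))) (ln (x \<bullet> x)))"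
    by (rule times_differentiable_on_compose[OF _ _ _ ln, rotated 2]) auto
  then have 1: "times_differentiable_on k (- {0}) (u :: 'a \<Rightarrow> real)"
    by (simp add: u_def[abs_def])
  have 2: "times_differentiable_on k (ball 0 (exp (a * L))) (u :: 'a \<Rightarrow> real)"
    by (rule times_differentiable_on_cong[OF open_ball _ times_differentiable_on_const[OF open_ball, where c = 0]])
      (use u_support(1) in force)
  have "- {0} \<union> ball 0 (exp (a * L)) = (UNIV :: 'a set)"
    by auto
  then show ?thesis
    using times_differentiable_on_Un[OF 1 2] by simp
qed

lemma u_test_function:
  assumes "cball 0 (exp (b * L)) \<subseteq> \<Omega>"
  shows "u \<in> test_functions (\<Omega> :: 'a::euclidean_space set)"
proof -
  have sub: "closure {x::'a. u x \<noteq> 0} \<subseteq> cball 0 (exp (b * L))"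
    by (rule closure_minimal) (auto simp: less_imp_le dest: u_support(2))
  then have "compact (closure {x::'a. u x \<noteq> 0})"
    by (meson bounded_cball bounded_subset closed_closure compact_eq_bounded_closed)
  then show ?thesis
    using sub assms times_differentiable_on_u by (auto simp: test_functions_def intro: smooth_if_times_differentiable)
qed

text \<open>\<open>u\<close> depends on r = |x| alone, so the norm of its gradient is the modulus of
  its derivative in r.\<close>

lemma norm_gradient_u:
  fixes x :: "'a::euclidean_space"
  assumes "x \<noteq> 0"
  shows "norm (classical_gradient u x) =
    norm x powr (- \<gamma> - 1) * \<bar>\<gamma> * W (ln (norm x) / L) - W' (ln (norm x) / L) / L\<bar>"
proof -
  define t where "t = ln (x \<bullet> x)"
  \<comment> \<open>\<open>D\<close> is the derivative of \<open>u\<close> as a function of t = ln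
    (x . x) = 2 ln |x|, whence the halved constants; the derivative of x . x returns the factor
    2.\<close>
  define D where "D = exp (t * (- \<gamma> / 2)) * (W' (t * (1 / (2 * L))) / (2 * L) - \<gamma> / 2 * W (t * (1 / (2 * L))))"
  have "((\<lambda>t. exp (t * (- \<gamma> / 2)) * W (t * (1 / (2 * L)))) has_real_derivative D) (at t)"
  proof (rule DERIV_cong[OF DERIV_mult])
    show "((\<lambda>t. exp (t * (- \<gamma> / 2))) has_real_derivative exp (t * (- \<gamma> / 2)) * (- \<gamma> / 2)) (at t)"
      by (auto intro!: derivative_eq_intros)
    show "((\<lambda>t. W (t * (1 / (2 * L)))) has_real_derivative W' (t * (1 / (2 * L))) * (1 / (2 * L))) (at t)"
      by (rule DERIV_chain2[OF W_deriv]) (use L_pos in \<open>auto intro!: derivative_eq_intros\<close>)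
  qed (use L_pos in \<open>simp add: D_def algebra_simps\<close>)
  then have "((\<lambda>t. exp (t \<bullet> (- \<gamma> / 2)) * W (t \<bullet> (1 / (2 * L)))) has_derivative (\<lambda>h. D * h)) (at (ln (x \<bullet> x)))"
    by (simp add: has_field_derivative_def t_def)
  moreover have "((\<lambda>x. ln (x \<bullet> x)) has_derivative (\<lambda>h. (2 * (x \<bullet> h)) / (x \<bullet> x))) (at x)"
    using assms by (auto intro!: derivative_eq_intros simp: inner_commute field_simps)
  ultimately have "(u has_derivative (\<lambda>h. D * ((2 * (x \<bullet> h)) / (x \<bullet> x)))) (at x)"
    unfolding u_def[abs_def] by (rule has_derivative_compose[rotated])
  then have "partial_deriv i u x = (2 * D / (x \<bullet> x)) * (x \<bullet> i)" for i
    by (subst partial_deriv_eq) (auto simp: field_simps)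
  then have "classical_gradient u x = (2 * D / (x \<bullet> x)) *\<^sub>R (\<Sum>i\<in>Basis. (x \<bullet> i) *\<^sub>R i)"
    by (simp add: classical_gradient_def scaleR_sum_right)
  then have "norm (classical_gradient u x) = \<bar>2 * D / (x \<bullet> x)\<bar> * norm x"
    by (simp add: euclidean_representation)
  also have "\<dots> = \<bar>2 * D\<bar> / norm x"
    using assms by (simp add: dot_square_norm power2_eq_square)
  also have "\<bar>2 * D\<bar> = norm x powr - \<gamma> * \<bar>\<gamma> * W (ln (norm x) / L) - W' (ln (norm x) / L) / L\<bar>"
  proof -
    have "2 * D = - (norm x powr - \<gamma> * (\<gamma> * W (ln (norm x) / L) - W' (ln (norm x) / L) / L))"
      using assms by (simp add: D_def t_def ln_inner_self powr_def algebra_simps)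
    then show ?thesis
      by (simp add: abs_mult)
  qed
  finally show ?thesis
    using assms by (simp add: powr_diff powr_minus)
qed

text \<open>Since (\<gamma> + 1) p = N, the p-th power of the gradient norm carries the weight
  |x|^(-N), exactly the one that logarithmic polar coordinates absorb.\<close>

lemma integral_gradient_u:
  assumes test: "u \<in> test_functions (\<Omega> :: 'a::euclidean_space set)"
    and p: "0 < p" and \<gamma>: "\<gamma> * p = real DIM('a) - p"
  shows "(LINT x:\<Omega>|lebesgue. norm (classical_gradient u x) powr p) =
    unit_ball_vol (real DIM('a)) * real DIM('a) * (L * (\<integral>s. \<bar>\<gamma> * W s - W' s / L\<bar> powr p \<partial>lborel))"
proof -
  have cW: "continuous_on UNIV W"
    by (intro continuous_at_imp_continuous_on ballI DERIV_isCont[OF W_deriv])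
  have [measurable]: "W \<in> borel_measurable borel" "W' \<in> borel_measurable borel"
    using cW W'_cont by (simp_all add: borel_measurable_continuous_onI)
  have [measurable]: "classical_gradient (u :: 'a \<Rightarrow> real) \<in> borel_measurable borel"
    using test_function_smooth[OF test] by (simp add: borel_measurable_continuous_onI continuous_classical_gradient)
  have "(LINT x:\<Omega>|lebesgue. norm (classical_gradient u x) powr p) =
      (\<integral>x. norm (classical_gradient (u :: 'a \<Rightarrow> real) x) powr p \<partial>lborel)"
    by (rule set_integral_lebesgue_eq_lborel, measurable)
      (simp add: classical_gradient_def test_function_partial_deriv_eq_0[OF test])
  also have "\<dots> = (\<integral>x. norm (x::'a) powr - real DIM('a) *
      (\<lambda>s. \<bar>\<gamma> * W s - W' s / L\<bar> powr p) (ln (norm x) / L) \<partial>lborel)"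
  proof (rule integral_cong_AE)
    have "AE x in lborel. x \<noteq> (0::'a)"
      by (rule AE_lborel_singleton)
    then show "AE x in lborel. norm (classical_gradient (u :: 'a \<Rightarrow> real) x) powr p =
        norm (x::'a) powr - real DIM('a) * \<bar>\<gamma> * W (ln (norm x) / L) - W' (ln (norm x) / L) / L\<bar> powr p"
    proof eventually_elim
      case (elim x)
      have "(- \<gamma> - 1) * p = - real DIM('a)" using \<gamma> by (simp add: algebra_simps)
      then show ?case
        using elim by (simp add: norm_gradient_u powr_mult powr_powr)
    qed
  qed auto
  also have "\<dots> = unit_ball_vol (real DIM('a)) * real DIM('a) * (L * (\<integral>s. \<bar>\<gamma> * W s - W' s / L\<bar> powr p \<partial>lborel))"
    by (rule integral_norm_powr_ln_norm[OF _ L_pos]) measurable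
  finally show ?thesis .
qed

lemma integral_hardy_u:
  assumes test: "u \<in> test_functions (\<Omega> :: 'a::euclidean_space set)"
    and p: "0 < p" and \<gamma>: "\<gamma> * p = real DIM('a) - p"
  shows "(LINT x:\<Omega>|lebesgue. \<bar>u x\<bar> powr p / norm x powr p) =
    unit_ball_vol (real DIM('a)) * real DIM('a) * (L * (\<integral>s. \<bar>W s\<bar> powr p \<partial>lborel))"
proof -
  have "continuous_on UNIV W"
    by (intro continuous_at_imp_continuous_on ballI DERIV_isCont[OF W_deriv])
  then have [measurable]: "W \<in> borel_measurable borel"
    by (rule borel_measurable_continuous_onI)
  have [measurable]: "(u :: 'a \<Rightarrow> real) \<in> borel_measurable borel"
    using test_function_smooth[OF test] by (simp add: borel_measurable_continuous_onI smooth_imp_continuous)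
  have "(LINT x:\<Omega>|lebesgue. \<bar>u x\<bar> powr p / norm x powr p) = (\<integral>x. \<bar>u (x::'a)\<bar> powr p / norm x powr p \<partial>lborel)"
    by (rule set_integral_lebesgue_eq_lborel) (simp_all add: test_function_eq_0[OF test])
  also have "\<dots> = (\<integral>x. norm (x::'a) powr - real DIM('a) * (\<lambda>s. \<bar>W s\<bar> powr p) (ln (norm x) / L) \<partial>lborel)"
  proof (rule integral_cong_AE)
    have "AE x in lborel. x \<noteq> (0::'a)"
      by (rule AE_lborel_singleton)
    then show "AE x in lborel. \<bar>u (x::'a)\<bar> powr p / norm x powr p =
        norm x powr - real DIM('a) * \<bar>W (ln (norm x) / L)\<bar> powr p"
    proof eventually_elim
      case (elim x)
      \<comment> \<open>The Hardy weight contributes -p and |u|^p contributes -\<gamma> p: together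
        the same critical weight as for the gradient.\<close>
      have "- \<gamma> * p - p = - real DIM('a)" using \<gamma> by (simp add: algebra_simps)
      then have "norm x powr (- \<gamma> * p) / norm x powr p = norm x powr - real DIM('a)"
        by (metis powr_diff)
      moreover have "\<bar>u x\<bar> powr p = norm x powr (- \<gamma> * p) * \<bar>W (ln (norm x) / L)\<bar> powr p"
        using elim by (simp add: u_eq abs_mult powr_mult powr_powr)
      ultimately show ?case
        by (metis times_divide_eq_left)
    qed
  qed auto
  also have "\<dots> = unit_ball_vol (real DIM('a)) * real DIM('a) * (L * (\<integral>s. \<bar>W s\<bar> powr p \<partial>lborel))"
    by (rule integral_norm_powr_ln_norm[OF _ L_pos]) measurable
  finally show ?thesis .
qed

text \<open>On a ball whose radius is comparable to its distance from the origin, \<open>u\<close>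
  is at least a multiple of radius^(-\<gamma>), while |E|^(1/q) is a multiple of radius^\<gamma>.
  The radius cancels, so the bound does not depend on \<open>L\<close>.\<close>

lemma weak_Lq_norm_u_ge:
  assumes m: "\<And>s. s \<in> {-7/4..-5/4} \<Longrightarrow> m \<le> W s" "0 \<le> m"
    and L: "4 \<le> L" and \<gamma>: "0 \<le> \<gamma>" "\<gamma> = real DIM('a) / q"
    and \<Omega>: "cball 0 (exp (- L)) \<subseteq> (\<Omega> :: 'a::euclidean_space set)"
  shows "ennreal (m * 3 powr - \<gamma> * unit_ball_vol (real DIM('a)) powr (1 / q)) \<le> weak_Lq_norm q \<Omega> u"
proof -
  \<comment> \<open>This distance corresponds to s = -3/2, the midpoint of the window where
    \<open>W\<close> is at least \<open>m\<close>.\<close>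
  define \<rho> where "\<rho> = exp (- 3 / 2 * L)"
  have \<rho>: "0 < \<rho>" by (simp add: \<rho>_def)
  obtain e :: 'a where e: "norm e = 1" using norm_Basis SOME_Basis by blast
  define E where "E = ball (\<rho> *\<^sub>R e) (\<rho> / 2)"
  have x: "x \<noteq> 0 \<and> norm x \<le> 3 * (\<rho> / 2) \<and> ln (norm x) / L \<in> {-7/4..-5/4}" if "x \<in> E" for x
  proof -
    have d: "norm (\<rho> *\<^sub>R e - x) < \<rho> / 2" and nr: "norm (\<rho> *\<^sub>R e) = \<rho>"
      using that e \<rho> by (simp_all add: E_def dist_norm)
    have lo: "\<rho> / 2 < norm x"
      using norm_triangle_sub[of "\<rho> *\<^sub>R e" x] d nr by linarith
    have hi: "norm x < 3 * (\<rho> / 2)"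
      using norm_triangle_sub[of x "\<rho> *\<^sub>R e"] d nr by (simp add: norm_minus_commute)
    have "x \<noteq> 0" using lo \<rho> by auto
    then have "ln (\<rho> / 2) \<le> ln (norm x)" "ln (norm x) \<le> ln (\<rho> * (3 / 2))"
      using lo hi \<rho> by simp_all
    then have "- 3 / 2 * L - ln 2 \<le> ln (norm x)" "ln (norm x) \<le> - 3 / 2 * L + ln (3 / 2)"
      using \<rho> by (simp_all only: ln_div ln_mult) (simp_all add: \<rho>_def ln_div ln_mult)
    \<comment> \<open>Within the ball, ln |x| differs from ln \<rho> by at most 1, and 1 is at most
      L / 4 when \<open>4 \<le> L\<close>. This matches the half-width 1/4 of the window.\<close>
    moreover have "ln 2 \<le> (1::real)" "ln (3 / 2) \<le> (1::real)"
      using ln_le_minus_one[of 2] ln_le_minus_one[of "3 / 2"] by simp_all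
    ultimately have "- 7 / 4 * L \<le> ln (norm x)" "ln (norm x) \<le> - 5 / 4 * L"
      using L by linarith+
    then have "ln (norm x) / L \<in> {-7/4..-5/4}"
      using L_pos by (simp add: field_simps)
    with \<open>x \<noteq> 0\<close> hi show ?thesis by simp
  qed
  have "E \<subseteq> cball 0 (exp (- L))"
  proof
    fix y assume "y \<in> E"
    with x[OF this] have y: "y \<noteq> 0" "ln (norm y) / L \<le> - 5 / 4" by auto
    then have "ln (norm y) \<le> - L" using L_pos by (simp add: field_simps)
    then have "exp (ln (norm y)) \<le> exp (- L)" by simp
    then show "y \<in> cball 0 (exp (- L))" using y by simp
  qed
  then have sub: "E \<subseteq> \<Omega>" using \<Omega> by blast
  have \<omega>: "0 < unit_ball_vol (real DIM('a))" by simp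
  have meas: "measure lebesgue E = unit_ball_vol (real DIM('a)) * (\<rho> / 2) ^ DIM('a)"
    using \<rho> by (simp add: E_def content_ball)
  have "ennreal (((3 * (\<rho> / 2)) powr - \<gamma> * m) * measure lebesgue E powr (1 / q)) \<le> weak_Lq_norm q \<Omega> u"
  proof (rule weak_Lq_norm_ge[OF _ sub])
    show "E \<in> lmeasurable" by (simp add: E_def)
    show "0 < measure lebesgue E" using \<omega> \<rho> by (simp add: meas)
    show "0 \<le> (3 * (\<rho> / 2)) powr - \<gamma> * m" using m(2) by simp
    fix y assume "y \<in> E"
    note y = x[OF this]
    have "(3 * (\<rho> / 2)) powr - \<gamma> \<le> norm y powr - \<gamma>"
      using y \<gamma>(1) by (intro powr_mono2') auto
    then show "(3 * (\<rho> / 2)) powr - \<gamma> * m \<le> u y"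
      using y m by (simp add: u_eq mult_mono)
  qed
  also have "((3 * (\<rho> / 2)) powr - \<gamma> * m) * measure lebesgue E powr (1 / q) =
      m * 3 powr - \<gamma> * unit_ball_vol (real DIM('a)) powr (1 / q)"
  proof -
    have "((\<rho> / 2) ^ DIM('a)) powr (1 / q) = (\<rho> / 2) powr \<gamma>"
      using \<rho> by (simp add: powr_realpow[symmetric] powr_powr \<gamma>(2))
    moreover have "(\<rho> / 2) powr - \<gamma> * (\<rho> / 2) powr \<gamma> = 1"
      using \<rho> by (simp add: powr_minus)
    moreover have "(3 * (\<rho> / 2)) powr - \<gamma> = 3 powr - \<gamma> * (\<rho> / 2) powr - \<gamma>"
      using \<rho> by (intro powr_mult) 
    ultimately show ?thesis
      using \<omega> \<rho> by (simp add: meas powr_mult)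
  qed
  finally show ?thesis .
qed

end

section \<open>The contradiction as the logarithmic length tends to infinity\<close>

theorem proposition6p3:
  fixes p :: real and \<Omega> :: "(real ^ 'n) set"
  assumes "1 < p" and "p < real CARD('n)"
    and "open \<Omega>" and "connected \<Omega>" and "bounded \<Omega>" and "0 \<in> \<Omega>"
  shows "\<not> (\<exists>c::real. c > 0 \<and>
    (\<forall>u \<in> sobolev_W0 p \<Omega>. \<forall>grad_u. has_weak_gradient \<Omega> u grad_u \<longrightarrow>
       (LINT x:\<Omega>|lebesgue. norm (grad_u x) powr p)
         - \<bar>(real CARD('n) - p) / p\<bar> powr p
             * (LINT x:\<Omega>|lebesgue. \<bar>u x\<bar> powr p / norm x powr p)
       \<ge> c * enn2real (weak_Lq_norm (real CARD('n) * p / (real CARD('n) - p)) \<Omega> u) powr p))"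
proof clarify
  let ?N = "real CARD('n)"
  define \<gamma> where "\<gamma> = (?N - p) / p"
  define q where "q = ?N * p / (?N - p)"
  fix c :: real
  assume c: "0 < c" and ineq: "\<forall>u \<in> sobolev_W0 p \<Omega>. \<forall>grad_u. has_weak_gradient \<Omega> u grad_u \<longrightarrow>
       (LINT x:\<Omega>|lebesgue. norm (grad_u x) powr p) - \<bar>(?N - p) / p\<bar> powr p
             * (LINT x:\<Omega>|lebesgue. \<bar>u x\<bar> powr p / norm x powr p)
       \<ge> c * enn2real (weak_Lq_norm (?N * p / (?N - p)) \<Omega> u) powr p"
  have \<gamma>: "0 < \<gamma>" "\<gamma> * p = ?N - p" "\<gamma> = ?N / q" and q: "0 < q"
    using assms(1,2) by (simp_all add: \<gamma>_def q_def)
  obtain W where W: "\<And>k. times_differentiable_on k UNIV W"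
    "\<And>s. -2 < s \<Longrightarrow> s < -1 \<Longrightarrow> 0 < W s" "\<And>s::real. s \<notin> {-2<..<-1} \<Longrightarrow> W s = 0"
    using bump_function_exists[of "-2" "-1"] by blast
  define W' where "W' = partial_deriv 1 W"
  have W_diff: "W differentiable at s" for s
    using W(1)[of "Suc 0"] by simp
  have W_deriv: "(W has_real_derivative W' s) (at s)" for s
    using W_diff[of s] partial_deriv_real unfolding real_differentiable_def W'_def by metis
  have W'_cont: "continuous_on UNIV W'"
    using smooth_imp_continuous[OF smooth_partial_deriv[OF smooth_if_times_differentiable[OF W(1)]], of 1]
    by (simp add: W'_def)
  have "continuous_on {-7/4..-5/4} W"
    by (intro continuous_at_imp_continuous_on ballI DERIV_isCont[OF W_deriv])
  \<comment> \<open>The window is compact and lies inside the open interval where \<open>W\<close>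
    is positive, so the minimum of \<open>W\<close> over it is positive.\<close>
  then obtain s0 where s0: "s0 \<in> {-7/4..-5/4}" "\<forall>s\<in>{-7/4..-5/4}. W s0 \<le> W s"
    using continuous_attains_inf[of "{-7/4..-5/4}" W] by auto
  define m where "m = W s0"
  have m: "0 < m" using s0(1) W(2)[of s0] by (auto simp: m_def)
  obtain R where R: "0 < R" "cball 0 R \<subseteq> \<Omega>"
    using assms(3,6) open_contains_cball by metis
  define K where "K = m * 3 powr - \<gamma> * unit_ball_vol ?N powr (1 / q)"
  have "0 < unit_ball_vol ?N" by simp
  then have "unit_ball_vol ?N \<noteq> 0" by linarith
  then have K: "0 < K" using m by (simp add: K_def)
  \<comment> \<open>Up to the factor \<open>unit_ball_vol ?N * ?N\<close> this is the Hardy deficit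
    of the truncated extremal with L = n + 1.\<close>
  define D where "D n = real (Suc n) * ((\<integral>s. \<bar>\<gamma> * W s - W' s / real (Suc n)\<bar> powr p \<partial>lborel)
      - \<gamma> powr p * (\<integral>s. \<bar>W s\<bar> powr p \<partial>lborel))" for n
  have "D \<longlonglongrightarrow> 0"
    unfolding D_def
    by (rule scaled_deficit_tendsto_0[OF assms(1) \<gamma>(1) W_deriv W'_cont, of "-2" "-1"]) (use W(3) in auto)
  then have "(\<lambda>n. unit_ball_vol ?N * ?N * D n) \<longlonglongrightarrow> unit_ball_vol ?N * ?N * 0"
    by (intro tendsto_intros)
  moreover have "\<forall>\<^sub>F n in sequentially. c * K powr p \<le> unit_ball_vol ?N * ?N * D n"
  proof (rule eventually_sequentiallyI)
    \<comment> \<open>The threshold secures both L >= 4, for the weak-norm estimate, and exp (-L) <=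
      R, so that the support fits into \<open>\<Omega>\<close>.\<close>
    fix n assume "nat \<lceil>max 4 (- ln R)\<rceil> \<le> n"
    then have "max 4 (- ln R) \<le> real (Suc n)"
      by linarith
    then have L: "4 \<le> real (Suc n)" "- real (Suc n) \<le> ln R"
      by linarith+
    interpret log_profile W W' "-2" "-1" \<gamma> "real (Suc n)"
      by unfold_locales (use W W_deriv W'_cont in auto)
    have "exp (- real (Suc n)) \<le> exp (ln R)"
      using L(2) by (simp only: exp_le_cancel_iff)
    then have "exp (- real (Suc n)) \<le> R" using R(1) by simp
    then have ball: "cball 0 (exp (- real (Suc n))) \<subseteq> \<Omega>"
      using R(2) subset_cball by blast
    then have test: "u \<in> test_functions \<Omega>"
      by (intro u_test_function) simp
    obtain B where B: "\<And>x::real^'n. \<bar>u x\<bar> \<le> B"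
      using test_function_bounded[OF test] by blast
    have "ennreal K \<le> weak_Lq_norm q \<Omega> u"
      unfolding K_def
      using weak_Lq_norm_u_ge[of m q \<Omega>] s0(2) m L(1) \<gamma> ball by (simp add: m_def)
    moreover have "weak_Lq_norm q \<Omega> u < \<infinity>"
      by (rule weak_Lq_norm_finite[OF B q]) (use assms in \<open>simp add: lmeasurable_open\<close>)
    ultimately have "K \<le> enn2real (weak_Lq_norm q \<Omega> u)"
      using enn2real_mono[of "ennreal K" "weak_Lq_norm q \<Omega> u"] K by simp
    then have "c * K powr p \<le> c * enn2real (weak_Lq_norm q \<Omega> u) powr p"
      using c K assms(1) by (intro mult_left_mono powr_mono2) auto
    also have "\<dots> \<le> (LINT x:\<Omega>|lebesgue. norm (classical_gradient u x) powr p)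
        - \<bar>(?N - p) / p\<bar> powr p * (LINT x:\<Omega>|lebesgue. \<bar>u x\<bar> powr p / norm x powr p)"
      unfolding q_def using ineq test_function_in_sobolev_W0[OF test, of p]
        test_function_has_weak_gradient[OF test] assms(1) by simp
    also have "\<dots> = unit_ball_vol ?N * ?N * D n"
      using integral_gradient_u[OF test, of p] integral_hardy_u[OF test, of p] assms(1) \<gamma>(1,2)
      by (simp add: D_def \<gamma>_def[symmetric] algebra_simps)
    finally show "c * K powr p \<le> unit_ball_vol ?N * ?N * D n" .
  qed
  \<comment> \<open>The lower bound is the same for all large n, so it survives in the limit, where
    the deficit is 0.\<close>
  ultimately have "c * K powr p \<le> unit_ball_vol ?N * ?N * 0"
    by (intro tendsto_lowerbound) auto
  moreover have "0 < c * K powr p" using c K by simp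
  ultimately show False by linarith
qed

end
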